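(* Let $A \in \mathbb{R}^{p\times q}$, $B \in \mathbb{R}^{p\times m}$, and $C\in\mathbb{R}^{n\times q}$. Then there exist orthonormal matrices $P\in\mathbb{R}^{p\times p}$, $Q\in\mathbb{R}^{q\times q}$, $U\in\mathbb{R}^{m\times m}$, $V\in\mathbb{R}^{n\times n}$ and nonnegative integers $p_1,\dots,p_5$, $q_1,\dots,q_5$, $m_1,\dots,m_4$, $n_1,\dots,n_4$ with $\sum p_i=p$, $\sum q_i=q$, $\sum m_i=m$, $\sum n_i=n$ such that, with block rows and block columns of the indicated sizes, $$P^TAQ=\begin{bmatrix}0&0&A_{13}&A_{14}&A_{15}\\0&0&0&A_{24}&A_{25}\\0&0&0&0&A_{35}\\0&0&0&0&0\\0&0&0&0&0\end{bmatrix}$$ (block rows of sizes $p_1,\dots,p_5$, block columns of sizes $q_1,\dots,q_5$), $$P^TBU=\begin{bmatrix}0&B_{12}&B_{13}&B_{14}\\0&0&B_{23}&B_{24}\\0&0&0&B_{34}\\0&0&0&B_{44}\\0&0&0&0\end{bmatrix}$$ (block rows of sizes $p_1,\dots,p_5$, block columns of sizes $m_1,\dots,m_4$), and $$V^TCQ=\begin{bmatrix}0&C_{12}&C_{13}&C_{14}&C_{15}\\0&0&0&C_{24}&C_{25}\\0&0&0&0&C_{35}\\0&0&0&0&0\end{bmatrix}$$ (block rows of sizes $n_1,\dots,n_4$, block columns of sizes $q_1,\dots,q_5$), where $A_{13}$, $A_{24}$, $A_{35}$, $B_{44}$, and $C_{12}$ are nonsingular (in particular square) and upper triangular; $B_{23}$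 and $C_{24}$ are square and upper triangular; and $B_{12}$ and $C_{35}$ are upper trapezoidal with $p_1\ge m_2$ and $n_3\le q_5$, respectively. Furthermore, the matrices $A_{24}$, $B_{23}$, and $C_{24}$ are such that $C_{24}A_{24}^{-1}B_{23}=\Sigma$, where $\Sigma$ is diagonal with nonnegative entries.
   Context: An orthonormal matrix here is a square real matrix whose transpose is its inverse. Block sizes may be zero, in which case the corresponding block rows/columns are absent. Upper trapezoidal means the following. The matrix $B_{12}$ (of size $p_1\times m_2$, $p_1\ge m_2$) has $(i,j)$ entry zero whenever $i-j>p_1-m_2$, i.e. it consists of a full $(p_1-m_2)\times m_2$ block on top of an upper-triangular $m_2\times m_2$ block. The matrix $C_{35}$ (of size $n_3\times q_5$, $n_3\le q_5$) has $(i,j)$ entry zero whenever $i>j$. *)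

theory Defs
  imports "Jordan_Normal_Form.Matrix"
begin

(* The library's orthogonal_mat only asks for nonzero pairwise orthogonal columns,
   hence a separate notion. *)
definition orthonormal_mat :: "real mat \<Rightarrow> bool" where
  "orthonormal_mat M \<longleftrightarrow>
     square_mat M \<and> inverts_mat (transpose_mat M) M \<and> inverts_mat M (transpose_mat M)"

(* With truncated subtraction this covers both shapes: a tall matrix is a full block on top
   of an upper triangular one, while for a wide matrix the condition reads i > j. *)
definition upper_trapezoidal :: "'a::zero mat \<Rightarrow> bool" where
  "upper_trapezoidal M \<longleftrightarrow>
     (\<forall>i<dim_row M. \<forall>j<dim_col M. i > j + (dim_row M - dim_col M) \<longrightarrow> M $$ (i, j) = 0)"

definition append_cols :: "'a::zero mat \<Rightarrow> 'a mat \<Rightarrow> 'a mat" (infixr \<open>@\<^sub>c\<close> 65) where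
  "M @\<^sub>c N = four_block_mat M N (0\<^sub>m 0 (dim_col M)) (0\<^sub>m 0 (dim_col N))"

(* The height r is needed only to give the empty row its shape. *)
fun block_row :: "nat \<Rightarrow> 'a::zero mat list \<Rightarrow> 'a mat" where
  "block_row r [] = 0\<^sub>m r 0"
| "block_row r (M # Ms) = M @\<^sub>c block_row r Ms"

(* Block matrix with row heights rs and total width nc. Meaningful only when the blocks have
   matching dimensions; blocks with zero rows or columns are allowed. *)
fun block_mat :: "nat list \<Rightarrow> nat \<Rightarrow> 'a::zero mat list list \<Rightarrow> 'a mat" where
  "block_mat (r # rs) nc (Ms # Mss) = block_row r Ms @\<^sub>r block_mat rs nc Mss"
| "block_mat _ nc _ = 0\<^sub>m 0 nc"

lemma append_cols_carrier [simp, intro]: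
  "M \<in> carrier_mat r c1 \<Longrightarrow> N \<in> carrier_mat r c2 \<Longrightarrow> M @\<^sub>c N \<in> carrier_mat r (c1 + c2)"
  unfolding append_cols_def by auto

lemma index_append_cols:
  assumes "M \<in> carrier_mat r c1" "N \<in> carrier_mat r c2" "i < r" "j < c1 + c2"
  shows "(M @\<^sub>c N) $$ (i, j) = (if j < c1 then M $$ (i, j) else N $$ (i, j - c1))"
  using assms unfolding append_cols_def by auto

end

(* Allow X and Y to be merely invertible, and U, V orthonormal. Repeated singular value decompositions
   of suitable submatrices then bring (X A Y, X B U, V C Y) to a restricted singular value form in which
   X A Y is a shifted identity and the B- and C-forms consist of shifted identities and of one positive
   diagonal block Sigma, up to entries that need not be controlled. Each step acts by a block diagonal
   matrix X = diag(I, Z, I), with the inverse of Z at the matching place of Y, so that X A Y does not change.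
   Now take the QR factorization P R of the inverse of X and the RQ factorization S Q^T of the inverse of Y:
   P^T A Q = R (X A Y) S, P^T B U = R (X B U) and V C Q = (V C Y) S, and upper triangular R and S
   preserve the required zero pattern. In the distinguished block A24 = R22 S44, B23 = R22 Sigma and
   C24 = S44, whence C24 A24^{-1} B23 = Sigma. *)

theory Submission
  imports Defs "Jordan_Normal_Form.Determinant" "HOL-Analysis.Function_Topology"
begin

text \<open>Upper triangular factors spread entries only upwards (in \<open>R * K\<close>) or to the
  right (in \<open>K * S\<close>). So the reduced B and C must be known only on and below a
  staircase, and whatever lies above it may be spoilt freely; this is why a few local reductions are
  enough. The obstacle is a coupling: once A is a shifted identity, a factor Z on rows of B forces
  its inverse on the facing columns of C. The order of the steps is built around it. Rows of B and
  columns of C that face no unit of A are free and go first. Next C is compressed on the remaining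
  columns, which leaves a unit block. A further Z on the rows of B facing that block would destroy
  it unless an orthonormal factor on the rows of C undoes the damage, so Z must itself be
  orthonormal there: its singular values cannot be scaled to 1. They are the entries of Sigma, hence
  even positive. Units are pushed to the right edge of their windows so that the columns to their
  left vanish and stay available for later steps.\<close>

section \<open>Singular vectors\<close>

text \<open>A maximiser \<open>u\<close> of |F x|^2 on the unit sphere is an eigenvector of F^T F,
  and the maximum is its eigenvalue \<open>l\<close>. The nonzero entry of F makes this maximum
  positive.\<close>

lemma singular_vector_pair_aux:
  fixes f :: "nat \<Rightarrow> nat \<Rightarrow> real"
  assumes ne: "i0 < a" "j0 < b" "f i0 j0 \<noteq> 0"
  shows "\<exists>u l. l > 0 \<and> (\<Sum>j<b. (u j)\<^sup>2) = 1 \<and>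
    (\<forall>j<b. (\<Sum>i<a. f i j * (\<Sum>k<b. f i k * u k)) = l * u j)"
proof -
  define g where "g x = (\<Sum>i<a. (\<Sum>k<b. f i k * x k)\<^sup>2)" for x :: "nat \<Rightarrow> real"
  define N where "N x = (\<Sum>j<b. (x j)\<^sup>2)" for x :: "nat \<Rightarrow> real"
  \<comment> \<open>\<open>N\<close> does not see the coordinates from \<open>b\<close> on. Freezing
    them at 0 turns the sphere into a closed subset of a product of compact sets, compact by
    Tychonoff.\<close>
  define D where "D = PiE UNIV (\<lambda>i. if i < b then {-1..1::real} else {0})"
  define K where "K = D \<inter> {x. N x = 1}"
  have coord: "continuous_on S (\<lambda>x::nat\<Rightarrow>real. x j)" for S j
    by (rule continuous_on_product_coordinates[THEN continuous_on_subset]) auto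
  have cN: "continuous_on UNIV N" and cg: "continuous_on UNIV g"
    unfolding N_def g_def by (intro continuous_intros coord)+
  have "compactin (product_topology (\<lambda>i. euclidean) UNIV) D"
    unfolding D_def compactin_PiE by auto
  hence "compact D" by (simp add: euclidean_product_topology)
  moreover have "closed {x. N x = 1}"
    by (intro closed_Collect_eq cN continuous_intros)
  ultimately have cK: "compact K" unfolding K_def by (rule compact_Int_closed)
  define e where "e = (\<lambda>j. if j = j0 then 1 else 0 :: real)"
  have Ne: "N e = 1" unfolding N_def e_def using ne by (simp add: if_distrib[of "\<lambda>x. x^2"] sum.delta cong: if_cong)
  have eK: "e \<in> K" unfolding K_def D_def using Ne ne by (auto simp: e_def PiE_def)
  obtain u where uK: "u \<in> K" and umax: "\<And>x. x \<in> K \<Longrightarrow> g x \<le> g u"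
    using continuous_attains_sup[OF cK _ continuous_on_subset[OF cg]] eK by blast
  have Nu: "N u = 1" using uK by (simp add: K_def)
  have ge: "0 < g e"
  proof -
    have "(\<Sum>k<b. f i0 k * e k) = f i0 j0" unfolding e_def using ne by (simp add: if_distrib sum.delta cong: if_cong)
    hence "0 < (\<Sum>k<b. f i0 k * e k)\<^sup>2" using ne by simp
    also have "\<dots> \<le> g e" unfolding g_def using ne by (intro member_le_sum) auto
    finally show ?thesis .
  qed
  hence gu: "g u > 0" using umax[OF eK] by simp
  have hom: "g (\<lambda>j. c * x j) = c\<^sup>2 * g x" "N (\<lambda>j. c * x j) = c\<^sup>2 * N x" for c x
    unfolding g_def N_def by (simp_all add: sum_distrib_left power_mult_distrib[symmetric] mult.left_commute)
  have Nnn: "N x \<ge> 0" for x unfolding N_def by (simp add: sum_nonneg)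
  \<comment> \<open>By homogeneity the maximum on the sphere bounds the quotient of \<open>g\<close>
    and \<open>N\<close> everywhere, so \<open>u\<close> can be compared with perturbations that
    leave the sphere.\<close>
  have bound: "g x \<le> g u * N x" for x
  proof (cases "N x = 0")
    case True
    hence "\<forall>j<b. x j = 0" unfolding N_def by (simp add: sum_nonneg_eq_0_iff)
    hence "g x = 0" unfolding g_def by simp
    thus ?thesis using True by simp
  next
    case False
    hence pos: "N x > 0" using Nnn[of x] by simp
    define y where "y j = (if j < b then (1 / sqrt (N x)) * x j else 0)" for j
    have gy: "g y = g (\<lambda>j. (1 / sqrt (N x)) * x j)" unfolding g_def y_def by simp
    have Ny: "N y = N (\<lambda>j. (1 / sqrt (N x)) * x j)" unfolding N_def y_def by simp
    have N1: "N y = 1" unfolding Ny hom using pos by (simp add: power_divide)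
    have y1: "- 1 \<le> y j \<and> y j \<le> 1" if "j < b" for j
    proof -
      have "(y j)\<^sup>2 \<le> N y" unfolding N_def using that by (intro member_le_sum) auto
      thus ?thesis using N1 by (simp add: abs_square_le_1 abs_le_iff del: abs_divide)
    qed
    have y0: "y j = 0" if "\<not> j < b" for j using that by (simp add: y_def)
    have "y \<in> K" unfolding K_def D_def using N1 by (auto simp: PiE_def y0 y1)
    hence "g y \<le> g u" by (rule umax)
    thus ?thesis unfolding gy hom using pos by (simp add: power_divide field_simps)
  qed
  define w where "w i = (\<Sum>k<b. f i k * u k)" for i
  have "(\<Sum>i<a. f i j * w i) = g u * u j" if j: "j < b" for j
  proof -
    \<comment> \<open>First-order condition without derivatives: coordinate \<open>j\<close> of
      \<open>u\<close> is moved by \<open>t\<close>, and \<open>bound\<close> becomes an inequality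
      between quadratic polynomials in \<open>t\<close> whose linear coefficient is
      \<open>2 * d\<close>.\<close>
    define d where "d = (\<Sum>i<a. f i j * w i) - g u * u j"
    define c where "c = (\<Sum>i<a. (f i j)\<^sup>2)"
    have lin: "(\<Sum>k<b. f i k * (u(j := u j + t)) k) = w i + t * f i j" for i t
    proof -
      have "(\<Sum>k<b. f i k * (u(j := u j + t)) k) = (\<Sum>k<b. f i k * u k + (if k = j then t * f i j else 0))"
        by (rule sum.cong) (auto simp: algebra_simps)
      thus ?thesis using j by (simp add: sum.distrib w_def)
    qed
    have gt: "g (u(j := u j + t)) = g u + 2 * t * (\<Sum>i<a. f i j * w i) + t\<^sup>2 * c" for t
      unfolding g_def lin unfolding c_def w_def[symmetric]
      by (simp add: power2_eq_square algebra_simps sum.distrib sum_distrib_left)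
    have Nt: "N (u(j := u j + t)) = 1 + 2 * t * u j + t\<^sup>2" for t
    proof -
      have "N (u(j := u j + t)) = (\<Sum>k<b. (u k)\<^sup>2 + (if k = j then 2 * t * u j + t\<^sup>2 else 0))"
        unfolding N_def by (rule sum.cong) (auto simp: power2_eq_square algebra_simps)
      thus ?thesis using j Nu by (simp add: sum.distrib N_def)
    qed
    have key: "2 * t * d + t\<^sup>2 * (c - g u) \<le> 0" for t
      using bound[of "u(j := u j + t)"] unfolding gt Nt d_def by (simp add: algebra_simps)
    have "d = 0"
    proof (rule ccontr)
      assume d0: "d \<noteq> 0"
      \<comment> \<open>At t = d / z the linear term gives 2 d^2 / z and the quadratic term at least
        - d^2 / z, so the sum would be positive.\<close>
      define z where "z = \<bar>c - g u\<bar> + 1"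
      have z: "z > 0" "\<bar>c - g u\<bar> < z" unfolding z_def by auto
      have "2 * (d / z) * d + (d/z)\<^sup>2 * (c - g u) \<le> 0" by (rule key)
      moreover have "(d/z)\<^sup>2 * (c - g u) \<ge> - ((d/z)\<^sup>2 * z)"
        using mult_left_mono[of "-z" "c - g u" "(d/z)\<^sup>2"] z by auto
      moreover have "(d/z)\<^sup>2 * z = d\<^sup>2 / z" "2 * (d / z) * d = 2 * (d\<^sup>2 / z)"
        using z by (auto simp: power2_eq_square)
      moreover have "d\<^sup>2 / z > 0" using d0 z by simp
      ultimately show False by linarith
    qed
    thus ?thesis unfolding d_def by simp
  qed
  thus ?thesis using gu Nu unfolding N_def w_def by blast
qed

text \<open>From F^T F u = l u take s = sqrt l and v = F u / s; v is a unit vector because |F u|^2 =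
  u^T F^T F u = l.\<close>

lemma singular_vector_pair:
  fixes f :: "nat \<Rightarrow> nat \<Rightarrow> real"
  assumes ne: "i0 < a" "j0 < b" "f i0 j0 \<noteq> 0"
  obtains u v s where "s > 0" "(\<Sum>j<b. (u j)\<^sup>2) = 1" "(\<Sum>i<a. (v i)\<^sup>2) = 1"
    "\<And>i. i < a \<Longrightarrow> (\<Sum>k<b. f i k * u k) = s * v i"
    "\<And>j. j < b \<Longrightarrow> (\<Sum>i<a. f i j * v i) = s * u j"
proof -
  obtain u l where l: "l > 0" and u: "(\<Sum>j<b. (u j)\<^sup>2) = 1"
    and eig: "\<And>j. j < b \<Longrightarrow> (\<Sum>i<a. f i j * (\<Sum>k<b. f i k * u k)) = l * u j"
    using singular_vector_pair_aux[of i0 a j0 b f, OF ne] by blast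
  define w where "w i = (\<Sum>k<b. f i k * u k)" for i
  define s where "s = sqrt l"
  have s: "s > 0" "s * s = l" using l by (auto simp: s_def)
  have "(\<Sum>i<a. (w i)\<^sup>2) = (\<Sum>i<a. \<Sum>j<b. f i j * u j * w i)"
    unfolding power2_eq_square by (subst w_def) (simp add: sum_distrib_right)
  also have "\<dots> = (\<Sum>j<b. u j * (\<Sum>i<a. f i j * w i))"
    by (subst sum.swap) (simp add: sum_distrib_left mult_ac)
  also have "\<dots> = (\<Sum>j<b. l * (u j)\<^sup>2)"
    using eig by (intro sum.cong) (auto simp: w_def power2_eq_square)
  also have "\<dots> = l" using u by (simp add: sum_distrib_left[symmetric])
  finally have ww: "(\<Sum>i<a. (w i)\<^sup>2) = l" .
  show ?thesis
  proof (rule that[of s u "\<lambda>i. w i / s"])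
    show "(\<Sum>i<a. (w i / s)\<^sup>2) = 1"
      using ww s l by (simp add: power_divide sum_divide_distrib[symmetric] power2_eq_square)
    show "(\<Sum>i<a. f i j * (w i / s)) = s * u j" if "j < b" for j
      using eig[OF that] s unfolding w_def[symmetric]
      by (simp add: sum_divide_distrib[symmetric] field_simps)
  qed (use s u in \<open>auto simp: w_def\<close>)
qed

section \<open>Embedded blocks and Householder reflections\<close>

lemma index_mult_mat_sum:
  "A \<in> carrier_mat a b \<Longrightarrow> B \<in> carrier_mat b c \<Longrightarrow> i < a \<Longrightarrow> j < c \<Longrightarrow>
    (A * B) $$ (i, j) = (\<Sum>k<b. A $$ (i, k) * B $$ (k, j))"
  by (simp add: scalar_prod_def atLeast0LessThan)

lemma orthonormal_mat_iff:
  "M \<in> carrier_mat n n \<Longrightarrow> orthonormal_mat M \<longleftrightarrow> transpose_mat M * M = 1\<^sub>m n"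
  using mat_mult_left_right_inverse[of "transpose_mat M" n M]
  unfolding orthonormal_mat_def inverts_mat_def by auto

lemma orthonormal_mat_mult_transpose:
  "M \<in> carrier_mat n n \<Longrightarrow> orthonormal_mat M \<Longrightarrow> M * transpose_mat M = 1\<^sub>m n"
  unfolding orthonormal_mat_def inverts_mat_def by auto

lemma orthonormal_mat_transpose:
  "M \<in> carrier_mat n n \<Longrightarrow> orthonormal_mat M \<Longrightarrow> orthonormal_mat (transpose_mat M)"
  unfolding orthonormal_mat_def inverts_mat_def by auto

lemma orthonormal_mat_one: "orthonormal_mat (1\<^sub>m n)"
  by (simp add: orthonormal_mat_iff[of _ n])

lemma mat_mult_middle_inverse:
  fixes A B C D :: "real mat"
  assumes "A \<in> carrier_mat n n" "B \<in> carrier_mat n n" "C \<in> carrier_mat n n" "D \<in> carrier_mat n n"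
    "B * C = 1\<^sub>m n" "A * D = 1\<^sub>m n"
  shows "(A * B) * (C * D) = 1\<^sub>m n"
proof -
  have "(A * B) * (C * D) = A * (B * (C * D))"
    by (rule assoc_mult_mat[OF assms(1,2) mult_carrier_mat[OF assms(3,4)]])
  also have "B * (C * D) = (B * C) * D"
    by (rule assoc_mult_mat[OF assms(2,3,4), symmetric])
  finally show ?thesis using assms by simp
qed

lemma mat_mult_regroup:
  fixes X V M U Y :: "real mat"
  assumes "X \<in> carrier_mat a a" "V \<in> carrier_mat a a" "M \<in> carrier_mat a b"
    "U \<in> carrier_mat b b" "Y \<in> carrier_mat b b"
  shows "(X * V) * M * (U * Y) = X * (V * M * U) * Y"
proof -
  have "(X * V) * M * (U * Y) = ((X * V) * M * U) * Y"
    by (rule assoc_mult_mat[symmetric, of _ a b _ b _ b]) (use assms in auto)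
  moreover have "(X * V) * M = X * (V * M)"
    by (rule assoc_mult_mat[of _ a a _ a _ b]) (use assms in auto)
  moreover have "X * (V * M) * U = X * (V * M * U)"
    by (rule assoc_mult_mat[of _ a a _ b _ b]) (use assms in auto)
  ultimately show ?thesis by simp
qed

lemma orthonormal_mat_mult:
  assumes "M \<in> carrier_mat n n" "N \<in> carrier_mat n n" "orthonormal_mat M" "orthonormal_mat N"
  shows "orthonormal_mat (M * N)"
proof -
  have "transpose_mat (M * N) * (M * N) = (transpose_mat N * transpose_mat M) * (M * N)"
    using assms by (simp add: transpose_mult)
  also have "\<dots> = 1\<^sub>m n"
    using assms by (intro mat_mult_middle_inverse) (auto simp: orthonormal_mat_iff[of _ n])
  finally show ?thesis using assms by (subst orthonormal_mat_iff[of _ n]) auto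
qed

text \<open>The inverse is carried along explicitly because the reductions use Z on one side and its
  inverse on the other.\<close>

definition inverse_pair :: "nat \<Rightarrow> real mat \<Rightarrow> real mat \<Rightarrow> bool" where
  "inverse_pair n X Y \<longleftrightarrow>
     X \<in> carrier_mat n n \<and> Y \<in> carrier_mat n n \<and> X * Y = 1\<^sub>m n \<and> Y * X = 1\<^sub>m n"

lemma inverse_pairI:
  "X \<in> carrier_mat n n \<Longrightarrow> Y \<in> carrier_mat n n \<Longrightarrow> X * Y = 1\<^sub>m n \<Longrightarrow> inverse_pair n X Y"
  unfolding inverse_pair_def using mat_mult_left_right_inverse by blast

lemma inverse_pair_sym: "inverse_pair n X Y \<Longrightarrow> inverse_pair n Y X"
  unfolding inverse_pair_def by blast

lemma inverse_pair_mult: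
  "inverse_pair n X Xi \<Longrightarrow> inverse_pair n Y Yi \<Longrightarrow> inverse_pair n (X * Y) (Yi * Xi)"
  by (rule inverse_pairI) (auto simp: inverse_pair_def intro!: mat_mult_middle_inverse)

lemma inverse_pair_orthonormal:
  "M \<in> carrier_mat n n \<Longrightarrow> orthonormal_mat M \<Longrightarrow> inverse_pair n M (transpose_mat M)"
  by (rule inverse_pairI) (auto simp: orthonormal_mat_mult_transpose)

text \<open>This is diag(I, M, I) of size \<open>n\<close> with the square block \<open>M\<close>
  starting at index \<open>d\<close>. A block reaching beyond \<open>n\<close> would be cut off,
  hence the recurring hypothesis \<open>d + k \<le> n\<close>.\<close>

definition embed_mat :: "nat \<Rightarrow> nat \<Rightarrow> real mat \<Rightarrow> real mat" where
  "embed_mat n d M = mat n n (\<lambda>(i, j).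
     if d \<le> i \<and> i < d + dim_row M \<and> d \<le> j \<and> j < d + dim_row M then M $$ (i - d, j - d)
     else if i = j then 1 else 0)"

lemma embed_mat_carrier [simp]: "embed_mat n d M \<in> carrier_mat n n"
  and dim_embed_mat [simp]: "dim_row (embed_mat n d M) = n" "dim_col (embed_mat n d M) = n"
  unfolding embed_mat_def by auto

lemma transpose_embed_mat:
  "M \<in> carrier_mat k k \<Longrightarrow> transpose_mat (embed_mat n d M) = embed_mat n d (transpose_mat M)"
  unfolding embed_mat_def by (rule eq_matI) auto

lemma index_embed_mult:
  assumes M: "M \<in> carrier_mat k k" and d: "d + k \<le> n" and B: "B \<in> carrier_mat n c"
    and ij: "i < n" "j < c"
  shows "(embed_mat n d M * B) $$ (i, j) =
    (if d \<le> i \<and> i < d + k then (\<Sum>l<k. M $$ (i - d, l) * B $$ (d + l, j)) else B $$ (i, j))"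
proof -
  have eq: "(embed_mat n d M * B) $$ (i, j) = (\<Sum>l<n. embed_mat n d M $$ (i, l) * B $$ (l, j))"
    by (rule index_mult_mat_sum[OF _ B ij]) simp
  show ?thesis
  proof (cases "d \<le> i \<and> i < d + k")
    case True
    have "(\<Sum>l<n. embed_mat n d M $$ (i, l) * B $$ (l, j)) =
        (\<Sum>l=d..<d + k. M $$ (i - d, l - d) * B $$ (l, j))"
      using True M d ij by (intro sum.mono_neutral_cong_right) (auto simp: embed_mat_def)
    also have "\<dots> = (\<Sum>l<k. M $$ (i - d, l) * B $$ (d + l, j))"
      using sum.shift_bounds_nat_ivl[of "\<lambda>l. M $$ (i - d, l - d) * B $$ (l, j)" 0 d k]
      by (simp add: atLeast0LessThan add.commute)
    finally show ?thesis using True eq by simp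
  next
    case False
    have "(\<Sum>l<n. embed_mat n d M $$ (i, l) * B $$ (l, j)) =
        (\<Sum>l<n. if l = i then B $$ (i, j) else 0)"
      using False M d ij by (intro sum.cong) (auto simp: embed_mat_def)
    also have "\<dots> = B $$ (i, j)" using ij by simp
    finally show ?thesis unfolding eq if_not_P[OF False] .
  qed
qed

text \<open>Transposition reduces this to \<open>index_embed_mult\<close>.\<close>

lemma index_mult_embed:
  assumes M: "M \<in> carrier_mat k k" and d: "d + k \<le> n" and B: "B \<in> carrier_mat c n"
    and ij: "i < c" "j < n"
  shows "(B * embed_mat n d M) $$ (i, j) =
    (if d \<le> j \<and> j < d + k then (\<Sum>l<k. B $$ (i, d + l) * M $$ (l, j - d)) else B $$ (i, j))"
proof -
  have "(B * embed_mat n d M) $$ (i, j) = transpose_mat (B * embed_mat n d M) $$ (j, i)"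
    using B ij by simp
  also have "transpose_mat (B * embed_mat n d M) = embed_mat n d (transpose_mat M) * transpose_mat B"
    by (simp add: transpose_mult[OF B embed_mat_carrier] transpose_embed_mat[OF M])
  also have "(embed_mat n d (transpose_mat M) * transpose_mat B) $$ (j, i) =
     (if d \<le> j \<and> j < d + k then (\<Sum>l<k. transpose_mat M $$ (j - d, l) * transpose_mat B $$ (d + l, i))
      else transpose_mat B $$ (j, i))"
    using M B ij d by (intro index_embed_mult) auto
  also have "\<dots> = (if d \<le> j \<and> j < d + k then (\<Sum>l<k. B $$ (i, d + l) * M $$ (l, j - d)) else B $$ (i, j))"
    using M B ij d by (auto intro!: sum.cong)
  finally show ?thesis .
qed

lemma index_embed_mat:
  assumes "M \<in> carrier_mat k k" "i < n" "j < n"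
  shows "embed_mat n d M $$ (i, j) = (if d \<le> i \<and> i < d + k \<and> d \<le> j \<and> j < d + k
    then M $$ (i - d, j - d) else if i = j then 1 else 0)"
  using assms unfolding embed_mat_def by simp

lemma embed_mat_mult:
  assumes M: "M \<in> carrier_mat k k" "N \<in> carrier_mat k k" and d: "d + k \<le> n"
  shows "embed_mat n d M * embed_mat n d N = embed_mat n d (M * N)"
proof (rule eq_matI)
  fix i j assume "i < dim_row (embed_mat n d (M * N))" "j < dim_col (embed_mat n d (M * N))"
  hence ij: "i < n" "j < n" by auto
  note eq = index_embed_mult[OF M(1) d embed_mat_carrier ij, of d N]
  note MN = index_embed_mat[OF mult_carrier_mat[OF M] ij, of d]
  show "(embed_mat n d M * embed_mat n d N) $$ (i, j) = embed_mat n d (M * N) $$ (i, j)"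
  proof (cases "d \<le> i \<and> i < d + k")
    case i: True
    show ?thesis
    proof (cases "d \<le> j \<and> j < d + k")
      case j: True
      have "i - d < k" "j - d < k" using i j by auto
      note MNs = index_mult_mat_sum[OF M this]
      have "(\<Sum>l<k. M $$ (i - d, l) * embed_mat n d N $$ (d + l, j)) =
          (\<Sum>l<k. M $$ (i - d, l) * N $$ (l, j - d))"
        using d ij j by (intro sum.cong) (auto simp: index_embed_mat[OF M(2)])
      moreover have "d \<le> i \<and> i < d + k \<and> d \<le> j \<and> j < d + k" using i j by blast
      ultimately show ?thesis unfolding eq MN MNs if_P[OF i] by (simp only: if_True simp_thms)
    next
      case j: False
      have "(\<Sum>l<k. M $$ (i - d, l) * embed_mat n d N $$ (d + l, j)) = 0"
      proof (rule sum.neutral, rule ballI)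
        fix l assume "l \<in> {..<k}"
        hence "embed_mat n d N $$ (d + l, j) = 0"
          using d ij j index_embed_mat[OF M(2), of "d + l" n j d] by auto
        thus "M $$ (i - d, l) * embed_mat n d N $$ (d + l, j) = 0" by simp
      qed
      moreover have "\<not> (d \<le> i \<and> i < d + k \<and> d \<le> j \<and> j < d + k)" "i \<noteq> j" using i j by blast+
      ultimately show ?thesis unfolding eq MN if_P[OF i] by (simp only: if_False)
    qed
  next
    case False
    hence "\<not> (d \<le> i \<and> i < d + k \<and> d \<le> j \<and> j < d + k)" by blast
    thus ?thesis unfolding eq MN index_embed_mat[OF M(2) ij] if_not_P[OF False] by (simp only: if_False)
  qed
qed auto

lemma embed_mat_one: "embed_mat n d (1\<^sub>m k) = 1\<^sub>m n"
  unfolding embed_mat_def by (rule eq_matI) auto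

lemma inverse_pair_embed:
  assumes "inverse_pair k X Y" "d + k \<le> n"
  shows "inverse_pair n (embed_mat n d X) (embed_mat n d Y)"
proof (rule inverse_pairI)
  have "embed_mat n d X * embed_mat n d Y = embed_mat n d (X * Y)"
    using assms by (intro embed_mat_mult) (auto simp: inverse_pair_def)
  also have "X * Y = 1\<^sub>m k" using assms by (simp add: inverse_pair_def)
  finally show "embed_mat n d X * embed_mat n d Y = 1\<^sub>m n" by (simp only: embed_mat_one)
qed simp_all

lemma orthonormal_mat_embed:
  assumes M: "M \<in> carrier_mat k k" "orthonormal_mat M" and d: "d + k \<le> n"
  shows "orthonormal_mat (embed_mat n d M)"
proof -
  have "transpose_mat (embed_mat n d M) * embed_mat n d M = embed_mat n d (transpose_mat M * M)"
    unfolding transpose_embed_mat[OF M(1)] using M d by (intro embed_mat_mult) auto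
  also have "transpose_mat M * M = 1\<^sub>m k" using M orthonormal_mat_iff by blast
  finally show ?thesis using orthonormal_mat_iff[OF embed_mat_carrier] by (simp only: embed_mat_one)
qed

definition window :: "nat \<Rightarrow> nat \<Rightarrow> nat \<Rightarrow> nat \<Rightarrow> real mat \<Rightarrow> real mat" where
  "window d e r c M = mat r c (\<lambda>(i, j). M $$ (d + i, e + j))"

lemma window_carrier [simp]: "window d e r c M \<in> carrier_mat r c"
  and dim_window [simp]: "dim_row (window d e r c M) = r" "dim_col (window d e r c M) = c"
  unfolding window_def by auto

lemma index_window [simp]:
  "i < r \<Longrightarrow> j < c \<Longrightarrow> window d e r c M $$ (i, j) = M $$ (d + i, e + j)"
  unfolding window_def by simp

text \<open>Lifts a decomposition of a submatrix to the whole matrix: inside the window, block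
  diagonal factors act as their blocks alone.\<close>

lemma window_embed_mult:
  assumes X: "X \<in> carrier_mat r r" and U: "U \<in> carrier_mat c c" and B: "B \<in> carrier_mat p m"
    and d: "d + r \<le> p" and e: "e + c \<le> m"
  shows "window d e r c (embed_mat p d X * B * embed_mat m e U) = X * window d e r c B * U"
proof (rule eq_matI)
  fix i j assume "i < dim_row (X * window d e r c B * U)" "j < dim_col (X * window d e r c B * U)"
  hence ij: "i < r" "j < c" using X U by auto
  have XB: "(embed_mat p d X * B) \<in> carrier_mat p m" using B by auto
  have XW: "X * window d e r c B \<in> carrier_mat r c" using X by auto
  have "window d e r c (embed_mat p d X * B * embed_mat m e U) $$ (i, j) =
      (\<Sum>l<c. (embed_mat p d X * B) $$ (d + i, e + l) * U $$ (l, j))"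
    using ij d e by (simp add: index_mult_embed[OF U e XB] del: index_mult_mat(1))
  also have "\<dots> = (\<Sum>l<c. (X * window d e r c B) $$ (i, l) * U $$ (l, j))"
    using ij d e
    by (intro sum.cong) (simp_all add: index_embed_mult[OF X d B] index_mult_mat_sum[OF X, of _ c]
        del: index_mult_mat(1))
  also have "\<dots> = (X * window d e r c B * U) $$ (i, j)"
    by (rule index_mult_mat_sum[OF XW U ij, symmetric])
  finally show "window d e r c (embed_mat p d X * B * embed_mat m e U) $$ (i, j) = \<dots>" .
qed (use X U in auto)

text \<open>The columns of I - c w w^T are orthonormal once c |w|^2 = 2: the two cross terms - c w_i
  w_j cancel against c^2 |w|^2 w_i w_j.\<close>

lemma householder_sum:
  fixes w :: "nat \<Rightarrow> real"
  assumes c: "c * (\<Sum>k<n. (w k)\<^sup>2) = 2" and ij: "i < n" "j < n"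
  shows "(\<Sum>k<n. ((if k = i then 1 else 0) - c * w k * w i) * ((if k = j then 1 else 0) - c * w k * w j))
    = (if i = j then 1 else 0)"
proof -
  have "((if k = i then 1 else 0) - c * w k * w i) * ((if k = j then 1 else 0) - c * w k * w j) =
      (if k = i then (if i = j then 1 else 0) - c * w i * w j else 0)
      - (if k = j then c * w i * w j else 0) + (c * c * w i * w j) * (w k)\<^sup>2" for k
    by (cases "k = i"; cases "k = j") (simp_all add: power2_eq_square algebra_simps)
  hence "(\<Sum>k<n. ((if k = i then 1 else 0) - c * w k * w i) * ((if k = j then 1 else 0) - c * w k * w j))
    = (\<Sum>k<n. if k = i then (if i = j then 1 else 0) - c * w i * w j else 0)
      - (\<Sum>k<n. if k = j then c * w i * w j else 0) + (c * c * w i * w j) * (\<Sum>k<n. (w k)\<^sup>2)"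
    by (simp only: sum.distrib sum_subtractf sum_distrib_left)
  also have "(\<Sum>k<n. if k = i then (if i = j then 1 else 0) - c * w i * w j else 0)
      = (if i = j then 1 else 0) - c * w i * w j"
    using ij by (subst sum.delta) simp_all
  also have "(\<Sum>k<n. if k = j then c * w i * w j else 0) = c * w i * w j"
    using ij by (subst sum.delta) simp_all
  also have "(c * c * w i * w j) * (\<Sum>k<n. (w k)\<^sup>2) = (c * (\<Sum>k<n. (w k)\<^sup>2)) * (c * w i * w j)"
    by (simp only: mult_ac)
  finally show ?thesis unfolding c by simp
qed

text \<open>For a unit vector u this gives |u - e_0|^2 = - 2 (u_0 - 1), which fixes the constant of
  the Householder reflection.\<close>

lemma sum_square_shift:
  fixes u :: "nat \<Rightarrow> real"
  shows "(\<Sum>i<Suc n. (u i - (if i = 0 then 1 else 0))\<^sup>2) = (\<Sum>i<Suc n. (u i)\<^sup>2) + (1 - 2 * u 0)"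
proof -
  have "(u i - (if i = 0 then 1 else 0))\<^sup>2 = (u i)\<^sup>2 + (if i = 0 then 1 - 2 * u 0 else 0)" for i
    by (cases "i = 0") (simp_all add: power2_diff)
  thus ?thesis by (simp only: sum.distrib) (subst sum.delta, simp_all)
qed

text \<open>One reflection completes a unit vector to an orthonormal basis. If the vector is already
  e_0, the reflection direction vanishes and the identity takes its place.\<close>

lemma orthonormal_first_column:
  assumes u: "(\<Sum>j<Suc n. (u j)\<^sup>2) = (1::real)"
  obtains H where "H \<in> carrier_mat (Suc n) (Suc n)" "orthonormal_mat H"
    "\<And>i. i < Suc n \<Longrightarrow> H $$ (i, 0) = u i"
proof (cases "\<forall>i<Suc n. u i = (if i = 0 then 1 else 0)")
  case True
  show ?thesis by (rule that[of "1\<^sub>m (Suc n)"]) (use True in \<open>auto simp: orthonormal_mat_one\<close>)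
next
  case False
  \<comment> \<open>The Householder reflection exchanging u and the first unit vector.\<close>
  define w where "w i = u i - (if i = 0 then 1 else 0)" for i :: nat
  define W where "W = (\<Sum>i<Suc n. (w i)\<^sup>2)"
  have W0: "W \<noteq> 0"
  proof
    assume "W = 0"
    hence "w i = 0" if "i < Suc n" for i
      using sum_nonneg_eq_0_iff[of "{..<Suc n}" "\<lambda>i. (w i)\<^sup>2"] that
      by (simp add: W_def del: sum.lessThan_Suc)
    thus False using False by (simp add: w_def)
  qed
  have "W = (\<Sum>i<Suc n. (u i)\<^sup>2) + (1 - 2 * u 0)"
    unfolding W_def w_def by (rule sum_square_shift)
  hence Ww: "W = - 2 * w 0" unfolding u by (simp add: w_def)
  define c where "c = 2 / W"
  have cW: "c * W = 2" using W0 by (simp add: c_def)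
  define H where "H = mat (Suc n) (Suc n) (\<lambda>(i, j). (if i = j then 1 else 0) - c * w i * w j)"
  have H: "H \<in> carrier_mat (Suc n) (Suc n)" unfolding H_def by simp
  have Hu: "H $$ (i, 0) = u i" if i: "i < Suc n" for i
  proof -
    \<comment> \<open>The constant gives c w_0 = -1, so the first column e_0 - c w_0 w is e_0 + w =
      u.\<close>
    have "c * w 0 = - (c * W) / 2" unfolding Ww by simp
    hence "c * w 0 = - 1" unfolding cW by simp
    moreover have "c * w i * w 0 = (c * w 0) * w i" by (simp only: mult_ac)
    ultimately have "c * w i * w 0 = - w i" by simp
    thus ?thesis using i unfolding H_def by (simp add: w_def)
  qed
  have "transpose_mat H * H = 1\<^sub>m (Suc n)"
  proof (rule eq_matI)
    fix i j assume "i < dim_row (1\<^sub>m (Suc n) :: real mat)" "j < dim_col (1\<^sub>m (Suc n) :: real mat)"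
    hence ij: "i < Suc n" "j < Suc n" by auto
    have "(transpose_mat H * H) $$ (i, j) = (\<Sum>k<Suc n. transpose_mat H $$ (i, k) * H $$ (k, j))"
      using H ij by (intro index_mult_mat_sum) auto
    also have "\<dots> = (\<Sum>k<Suc n. ((if k = i then 1 else 0) - c * w k * w i)
        * ((if k = j then 1 else 0) - c * w k * w j))"
      by (rule sum.cong) (use ij in \<open>simp_all add: H_def\<close>)
    also have "\<dots> = (if i = j then 1 else 0)"
      by (rule householder_sum[OF cW[unfolded W_def] ij])
    finally have "(transpose_mat H * H) $$ (i, j) = (if i = j then 1 else 0)" .
    thus "(transpose_mat H * H) $$ (i, j) = 1\<^sub>m (Suc n) $$ (i, j)"
      using ij by (simp del: index_mult_mat(1))
  qed (use H in auto)
  hence "orthonormal_mat H" using orthonormal_mat_iff[OF H] by blast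
  from that[OF H this Hu] show ?thesis .
qed

section \<open>Singular value decomposition and rank compression\<close>

text \<open>Induction peels off one singular pair: in orthonormal bases starting with v and u the
  first row and column of the matrix vanish off the corner, and the rest has one row fewer. The
  values \<open>s i\<close> come in no particular order.\<close>

lemma singular_value_decomposition:
  fixes M :: "real mat"
  assumes "M \<in> carrier_mat a b"
  shows "\<exists>V U l s. V \<in> carrier_mat a a \<and> orthonormal_mat V \<and> U \<in> carrier_mat b b \<and> orthonormal_mat U \<and>
    l \<le> a \<and> l \<le> b \<and> (\<forall>i<l. 0 < s i) \<and>
    V * M * U = mat a b (\<lambda>(i, j). if i = j \<and> i < l then s i else 0)"
  using assms
proof (induction a arbitrary: b M)
  case 0
  show ?case
    by (rule exI[of _ "1\<^sub>m 0"], rule exI[of _ "1\<^sub>m b"], rule exI[of _ 0], rule exI[of _ "\<lambda>_. 1"])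
      (use 0 in \<open>auto simp: orthonormal_mat_one\<close>)
next
  case (Suc a)
  note M = Suc.prems
  show ?case
  proof (cases "\<forall>i<Suc a. \<forall>j<b. M $$ (i, j) = 0")
    case True
    show ?thesis
      by (rule exI[of _ "1\<^sub>m (Suc a)"], rule exI[of _ "1\<^sub>m b"], rule exI[of _ 0], rule exI[of _ "\<lambda>_. 1"])
        (use M True in \<open>auto simp: orthonormal_mat_one\<close>)
  next
    case False
    then obtain i0 j0 where ne: "i0 < Suc a" "j0 < b" "M $$ (i0, j0) \<noteq> 0" by blast
    then obtain b' where b: "b = Suc b'" by (cases b) auto
    obtain u v s where s: "s > 0" and u: "(\<Sum>j<b. (u j)\<^sup>2) = 1" and v: "(\<Sum>i<Suc a. (v i)\<^sup>2) = 1"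
      and Mu: "\<And>i. i < Suc a \<Longrightarrow> (\<Sum>k<b. M $$ (i, k) * u k) = s * v i"
      and Mv: "\<And>j. j < b \<Longrightarrow> (\<Sum>i<Suc a. M $$ (i, j) * v i) = s * u j"
      by (rule singular_vector_pair[of i0 "Suc a" j0 b "\<lambda>i j. M $$ (i, j)", OF ne]) (rule that)
    obtain H where H: "H \<in> carrier_mat (Suc a) (Suc a)" "orthonormal_mat H"
        "\<And>i. i < Suc a \<Longrightarrow> H $$ (i, 0) = v i"
      by (rule orthonormal_first_column[OF v]) (rule that)
    obtain G where G: "G \<in> carrier_mat b b" "orthonormal_mat G"
        "\<And>i. i < b \<Longrightarrow> G $$ (i, 0) = u i"
      by (rule orthonormal_first_column[OF u[unfolded b]]) (rule that[unfolded b])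
    define N where "N = transpose_mat H * M * G"
    have MG: "M * G \<in> carrier_mat (Suc a) b" and HM: "transpose_mat H * M \<in> carrier_mat (Suc a) b"
      using M G H by auto
    have N: "N \<in> carrier_mat (Suc a) b" unfolding N_def using HM G by auto
    have N_alt: "N = transpose_mat H * (M * G)"
      unfolding N_def by (rule assoc_mult_mat[of _ "Suc a" "Suc a" _ b _ b]) (use H M G in auto)
    have HH: "(\<Sum>k<Suc a. H $$ (k, i) * H $$ (k, 0)) = (if i = 0 then 1 else 0)" if "i < Suc a" for i
      using index_mult_mat_sum[of "transpose_mat H" "Suc a" "Suc a" H "Suc a" i 0] H that
      by (simp add: orthonormal_mat_iff del: index_mult_mat(1) sum.lessThan_Suc)
    have GG: "(\<Sum>k<b. G $$ (k, 0) * G $$ (k, j)) = (if j = 0 then 1 else 0)" if "j < b" for j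
      using index_mult_mat_sum[of "transpose_mat G" b b G b 0 j] G that
      by (simp add: orthonormal_mat_iff del: index_mult_mat(1))
    \<comment> \<open>M u = s v is orthogonal to every column of \<open>H\<close> but the first.
      \<open>N_row\<close> rests in the same way on the transposed relation and on
      \<open>G\<close>.\<close>
    have N_col: "N $$ (i, 0) = (if i = 0 then s else 0)" if i: "i < Suc a" for i
    proof -
      have "N $$ (i, 0) = (\<Sum>k<Suc a. transpose_mat H $$ (i, k) * (M * G) $$ (k, 0))"
        unfolding N_alt by (rule index_mult_mat_sum[OF _ MG i]) (use H b in auto)
      also have "\<dots> = (\<Sum>k<Suc a. s * (H $$ (k, i) * H $$ (k, 0)))"
      proof (rule sum.cong)
        fix k assume "k \<in> {..<Suc a}"
        hence k: "k < Suc a" by simp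
        have "(M * G) $$ (k, 0) = (\<Sum>l<b. M $$ (k, l) * G $$ (l, 0))"
          by (rule index_mult_mat_sum[OF M G(1) k]) (use b in simp)
        also have "\<dots> = s * H $$ (k, 0)" using Mu[OF k] G(3) H(3)[OF k] by simp
        finally have "(M * G) $$ (k, 0) = s * H $$ (k, 0)" .
        thus "transpose_mat H $$ (i, k) * (M * G) $$ (k, 0) = s * (H $$ (k, i) * H $$ (k, 0))"
          using H(1) i k by (simp del: index_mult_mat(1))
      qed simp
      also have "\<dots> = s * (\<Sum>k<Suc a. H $$ (k, i) * H $$ (k, 0))"
        by (rule sum_distrib_left[symmetric])
      finally have "N $$ (i, 0) = s * (if i = 0 then 1 else 0)" unfolding HH[OF i] .
      thus ?thesis by (cases "i = 0") simp_all
    qed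
    have N_row: "N $$ (0, j) = (if j = 0 then s else 0)" if j: "j < b" for j
    proof -
      have "N $$ (0, j) = (\<Sum>k<b. (transpose_mat H * M) $$ (0, k) * G $$ (k, j))"
        unfolding N_def by (rule index_mult_mat_sum[OF HM G(1) _ j]) simp
      also have "\<dots> = (\<Sum>k<b. s * (G $$ (k, 0) * G $$ (k, j)))"
      proof (rule sum.cong)
        fix k assume "k \<in> {..<b}"
        hence k: "k < b" by simp
        have "(transpose_mat H * M) $$ (0, k) = (\<Sum>l<Suc a. transpose_mat H $$ (0, l) * M $$ (l, k))"
          by (rule index_mult_mat_sum[OF _ M _ k]) (use H in auto)
        also have "\<dots> = (\<Sum>l<Suc a. M $$ (l, k) * v l)"
          using H by (intro sum.cong) auto
        also have "\<dots> = s * G $$ (k, 0)" using Mv[OF k] G(3)[OF k] by simp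
        finally have "(transpose_mat H * M) $$ (0, k) = s * G $$ (k, 0)" .
        thus "(transpose_mat H * M) $$ (0, k) * G $$ (k, j) = s * (G $$ (k, 0) * G $$ (k, j))"
          by (simp del: index_mult_mat(1))
      qed simp
      also have "\<dots> = s * (\<Sum>k<b. G $$ (k, 0) * G $$ (k, j))"
        by (rule sum_distrib_left[symmetric])
      finally have "N $$ (0, j) = s * (if j = 0 then 1 else 0)" unfolding GG[OF j] .
      thus ?thesis by (cases "j = 0") simp_all
    qed
    obtain V U l s' where V: "V \<in> carrier_mat a a" "orthonormal_mat V"
      and U: "U \<in> carrier_mat b' b'" "orthonormal_mat U"
      and l: "l \<le> a" "l \<le> b'" and s': "\<And>i. i < l \<Longrightarrow> 0 < s' i"
      and eq: "V * window 1 1 a b' N * U = mat a b' (\<lambda>(i, j). if i = j \<and> i < l then s' i else 0)"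
      using Suc.IH[OF window_carrier[of 1 1 a b' N]] by blast
    define V1 where "V1 = embed_mat (Suc a) 1 V"
    define U1 where "U1 = embed_mat b 1 U"
    have V1: "V1 \<in> carrier_mat (Suc a) (Suc a)" "orthonormal_mat V1"
      unfolding V1_def using V by (auto intro!: orthonormal_mat_embed[of _ a])
    have U1: "U1 \<in> carrier_mat b b" "orthonormal_mat U1"
      unfolding U1_def using U b by (auto intro!: orthonormal_mat_embed[of _ b'])
    have VN: "V1 * N \<in> carrier_mat (Suc a) b" using V1 N by auto
    have ea: "1 + a \<le> Suc a" and eb: "1 + b' \<le> b" using b by auto
    have inner: "(V1 * N * U1) $$ (1 + i, 1 + j) = (if i = j \<and> i < l then s' i else 0)"
      if "i < a" "j < b'" for i j
    proof -
      have "(V1 * N * U1) $$ (1 + i, 1 + j) = window 1 1 a b' (V1 * N * U1) $$ (i, j)"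
        by (rule index_window[OF that, symmetric])
      also have "\<dots> = (V * window 1 1 a b' N * U) $$ (i, j)"
        unfolding V1_def U1_def window_embed_mult[OF V(1) U(1) N ea eb] ..
      also have "\<dots> = (if i = j \<and> i < l then s' i else 0)"
        unfolding eq using that by simp
      finally show ?thesis .
    qed
    have VN_row: "(V1 * N) $$ (0, j) = (if j = 0 then s else 0)" if "j < b" for j
      unfolding V1_def index_embed_mult[OF V(1) ea N zero_less_Suc that] N_row[OF that] by simp
    have VN_col: "(V1 * N) $$ (i, 0) = (if i = 0 then s else 0)" if i: "i < Suc a" for i
    proof -
      have b0: "0 < b" using b by simp
      have "(\<Sum>k<a. V $$ (i - 1, k) * N $$ (1 + k, 0)) = 0"
        by (rule sum.neutral) (simp add: N_col)
      thus ?thesis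
        unfolding V1_def index_embed_mult[OF V(1) ea N i b0] N_col[OF i] using i by simp
    qed
    have VNU: "(V1 * N * U1) $$ (i, j) = (if j = 0 then (V1 * N) $$ (i, 0)
        else (\<Sum>k<b'. (V1 * N) $$ (i, 1 + k) * U $$ (k, j - 1)))" if "i < Suc a" "j < b" for i j
      unfolding U1_def index_mult_embed[OF U(1) eb VN that]
      using that b by (simp del: index_mult_mat(1))
    \<comment> \<open>\<open>case_nat s s'\<close> puts the new value in front and shifts those of
      the induction hypothesis by one.\<close>
    have outer: "V1 * N * U1 = mat (Suc a) b (\<lambda>(i, j). if i = j \<and> i < Suc l then case_nat s s' i else 0)"
    proof (rule eq_matI)
      fix i j
      assume "i < dim_row (mat (Suc a) b (\<lambda>(i, j). if i = j \<and> i < Suc l then case_nat s s' i else 0))"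
        and "j < dim_col (mat (Suc a) b (\<lambda>(i, j). if i = j \<and> i < Suc l then case_nat s s' i else 0))"
      hence ij: "i < Suc a" "j < b" by auto
      consider "i = 0" | "i > 0" "j = 0" | i' j' where "i = 1 + i'" "j = 1 + j'"
        by (cases i; cases j) auto
      then have "(V1 * N * U1) $$ (i, j) = (if i = j \<and> i < Suc l then case_nat s s' i else 0)"
      proof cases
        case 1
        have "(\<Sum>k<b'. (V1 * N) $$ (0, 1 + k) * U $$ (k, j - 1)) = 0"
          by (rule sum.neutral) (use b in \<open>simp add: VN_row del: index_mult_mat(1)\<close>)
        thus ?thesis unfolding VNU[OF ij] unfolding 1
          using b by (cases "j = 0") (simp_all add: VN_row del: index_mult_mat(1))
      next
        case 2
        thus ?thesis unfolding VNU[OF ij] using ij by (simp add: VN_col del: index_mult_mat(1))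
      next
        case 3
        thus ?thesis using inner[of i' j'] ij b by (simp del: index_mult_mat(1))
      qed
      thus "(V1 * N * U1) $$ (i, j) = mat (Suc a) b (\<lambda>(i, j). if i = j \<and> i < Suc l then case_nat s s' i else 0) $$ (i, j)"
        using ij by (simp del: index_mult_mat(1))
    qed (use V1 U1 in auto)
    have "(V1 * transpose_mat H) * M * (G * U1) = V1 * N * U1"
      unfolding N_def by (rule mat_mult_regroup[of _ "Suc a" _ _ b]) (use V1 H M G U1 in auto)
    moreover have "orthonormal_mat (V1 * transpose_mat H)" "orthonormal_mat (G * U1)"
      using V1 H G U1 by (auto intro!: orthonormal_mat_mult orthonormal_mat_transpose)
    ultimately show ?thesis
      by (intro exI[of _ "V1 * transpose_mat H"] exI[of _ "G * U1"] exI[of _ "Suc l"]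
          exI[of _ "case_nat s s'"])
        (use outer V1 H G U1 l b s s' in \<open>auto split: nat.split\<close>)
  qed
qed

text \<open>A cyclic shift of the columns of the right factor moves the diagonal to the right
  edge.\<close>

lemma svd_right_aligned:
  fixes M :: "real mat"
  assumes M: "M \<in> carrier_mat a b"
  obtains V U l s where "V \<in> carrier_mat a a" "orthonormal_mat V" "U \<in> carrier_mat b b"
    "orthonormal_mat U" "l \<le> a" "l \<le> b" "\<And>i. i < l \<Longrightarrow> 0 < s i"
    "V * M * U = mat a b (\<lambda>(i, j). if j = b - l + i \<and> i < l then s i else 0)"
proof -
  obtain V U l s where V: "V \<in> carrier_mat a a" "orthonormal_mat V"
    and U: "U \<in> carrier_mat b b" "orthonormal_mat U"
    and l: "l \<le> a" "l \<le> b" and s: "\<And>i. i < l \<Longrightarrow> 0 < s i"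
    and eq: "V * M * U = mat a b (\<lambda>(i, j). if i = j \<and> i < l then s i else 0)"
    using singular_value_decomposition[OF M] by blast
  \<comment> \<open>Shift by \<open>l\<close> modulo \<open>b\<close>: column
    \<open>b - l + i\<close> of \<open>W\<close> is column \<open>i\<close> of \<open>U\<close> for
    \<open>i < l\<close>.\<close>
  define f where "f j = (if j + l < b then j + l else j + l - b)" for j
  have f: "f j < b" if "j < b" for j using that l by (auto simp: f_def)
  have f_eq: "f i = f j \<longleftrightarrow> i = j" if "i < b" "j < b" for i j using that l by (auto simp: f_def)
  define W where "W = mat b b (\<lambda>(i, j). U $$ (i, f j))"
  have W: "W \<in> carrier_mat b b" unfolding W_def by simp
  have "transpose_mat W * W = 1\<^sub>m b"
  proof (rule eq_matI)
    fix i j assume "i < dim_row (1\<^sub>m b :: real mat)" "j < dim_col (1\<^sub>m b :: real mat)"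
    hence ij: "i < b" "j < b" by auto
    have "(transpose_mat W * W) $$ (i, j) = (\<Sum>k<b. transpose_mat W $$ (i, k) * W $$ (k, j))"
      by (rule index_mult_mat_sum[OF _ W ij]) (use W in simp)
    also have "\<dots> = (\<Sum>k<b. U $$ (k, f i) * U $$ (k, f j))"
      by (rule sum.cong) (use ij in \<open>simp_all add: W_def\<close>)
    also have "\<dots> = (\<Sum>k<b. transpose_mat U $$ (f i, k) * U $$ (k, f j))"
      by (rule sum.cong) (use U(1) f ij in simp_all)
    also have "\<dots> = (transpose_mat U * U) $$ (f i, f j)"
      by (rule index_mult_mat_sum[OF _ U(1) f[OF ij(1)] f[OF ij(2)], symmetric]) (use U(1) in simp)
    also have "\<dots> = 1\<^sub>m b $$ (i, j)"
      unfolding iffD1[OF orthonormal_mat_iff[OF U(1)] U(2)] using f ij f_eq by simp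
    finally show "(transpose_mat W * W) $$ (i, j) = 1\<^sub>m b $$ (i, j)" .
  qed (use W in auto)
  hence oW: "orthonormal_mat W" using W by (simp add: orthonormal_mat_iff)
  have VM: "V * M \<in> carrier_mat a b" using V M by auto
  have "V * M * W = mat a b (\<lambda>(i, j). if j = b - l + i \<and> i < l then s i else 0)"
  proof (rule eq_matI)
    fix i j assume "i < dim_row (mat a b (\<lambda>(i, j). if j = b - l + i \<and> i < l then s i else 0))"
      "j < dim_col (mat a b (\<lambda>(i, j). if j = b - l + i \<and> i < l then s i else 0))"
    hence ij: "i < a" "j < b" by auto
    have "(V * M * W) $$ (i, j) = (\<Sum>k<b. (V * M) $$ (i, k) * U $$ (k, f j))"
      unfolding index_mult_mat_sum[OF VM W ij]
      by (rule sum.cong) (use ij in \<open>simp_all add: W_def del: index_mult_mat(1)\<close>)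
    also have "\<dots> = (V * M * U) $$ (i, f j)"
      by (rule index_mult_mat_sum[OF VM U(1) ij(1) f[OF ij(2)], symmetric])
    also have "\<dots> = (if i = f j \<and> i < l then s i else 0)"
      unfolding eq using ij f by simp
    also have "i = f j \<and> i < l \<longleftrightarrow> j = b - l + i \<and> i < l"
      using ij l by (auto simp: f_def)
    finally show "(V * M * W) $$ (i, j) =
        mat a b (\<lambda>(i, j). if j = b - l + i \<and> i < l then s i else 0) $$ (i, j)"
      using ij by simp
  qed (use V M W in auto)
  from that[OF V W oW l s this] show ?thesis .
qed

section \<open>Rank normal forms with one invertible and one orthonormal factor\<close>

lemma inverse_pair_diagonal:
  assumes "\<And>i. i < n \<Longrightarrow> d i \<noteq> 0"
  shows "inverse_pair n (mat n n (\<lambda>(i, j). if i = j then d i else 0))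
    (mat n n (\<lambda>(i, j). if i = j then 1 / d i else 0))"
proof (rule inverse_pairI, simp, simp, rule eq_matI)
  fix i j assume "i < dim_row (1\<^sub>m n :: real mat)" "j < dim_col (1\<^sub>m n :: real mat)"
  hence ij: "i < n" "j < n" by auto
  have "(mat n n (\<lambda>(i, j). if i = j then d i else 0) *
      mat n n (\<lambda>(i, j). if i = j then 1 / d i else 0)) $$ (i, j) =
    (\<Sum>k<n. mat n n (\<lambda>(i, j). if i = j then d i else 0) $$ (i, k) *
      mat n n (\<lambda>(i, j). if i = j then 1 / d i else 0) $$ (k, j))"
    by (rule index_mult_mat_sum[OF _ _ ij]) simp_all
  also have "\<dots> = (\<Sum>k<n. if k = i then (if i = j then 1 else 0) else 0)"
    by (rule sum.cong) (use ij assms in auto)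
  also have "\<dots> = 1\<^sub>m n $$ (i, j)" using ij by (subst sum.delta) simp_all
  finally show "(mat n n (\<lambda>(i, j). if i = j then d i else 0) *
      mat n n (\<lambda>(i, j). if i = j then 1 / d i else 0)) $$ (i, j) = 1\<^sub>m n $$ (i, j)" .
qed auto

abbreviation right_unit_block :: "nat \<Rightarrow> nat \<Rightarrow> nat \<Rightarrow> real mat" where
  "right_unit_block a b l \<equiv> mat a b (\<lambda>(i, j). if j = b - l + i \<and> i < l then 1 else 0)"

text \<open>The invertible factor absorbs the singular values. B admits only orthonormal column
  operations, so this version serves A and B; \<open>column_compression\<close> serves C, whose row
  operations must be orthonormal.\<close>

lemma row_compression:
  fixes M :: "real mat"
  assumes M: "M \<in> carrier_mat a b"
  obtains X Xi U l where "inverse_pair a X Xi" "U \<in> carrier_mat b b" "orthonormal_mat U"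
    "l \<le> a" "l \<le> b" "X * M * U = right_unit_block a b l"
proof -
  obtain V U l s where V: "V \<in> carrier_mat a a" "orthonormal_mat V"
    and U: "U \<in> carrier_mat b b" "orthonormal_mat U"
    and l: "l \<le> a" "l \<le> b" and s: "\<And>i. i < l \<Longrightarrow> 0 < s i"
    and eq: "V * M * U = mat a b (\<lambda>(i, j). if j = b - l + i \<and> i < l then s i else 0)"
    by (rule svd_right_aligned[OF M]) (rule that)
  define D where "D = mat a a (\<lambda>(i, j). if i = j then (if i < l then 1 / s i else 1) else 0)"
  have "(if i < l then 1 / s i else 1) \<noteq> 0" for i using s[of i] by auto
  then obtain Di where D: "inverse_pair a D Di"
    using inverse_pair_diagonal[of a "\<lambda>i. if i < l then 1 / s i else 1"] unfolding D_def
    by blast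
  have Dc: "D \<in> carrier_mat a a" unfolding D_def by simp
  have "D * V * M * U = D * (V * M * U)"
  proof -
    have "D * V * M * (U * 1\<^sub>m b) = D * (V * M * U) * 1\<^sub>m b"
      by (rule mat_mult_regroup[OF Dc V(1) M U(1)]) simp
    moreover have "D * (V * M * U) \<in> carrier_mat a b"
      by (rule mult_carrier_mat[OF Dc mult_carrier_mat[OF mult_carrier_mat[OF V(1) M] U(1)]])
    ultimately show ?thesis using right_mult_one_mat[OF U(1)] right_mult_one_mat[of _ a b] by simp
  qed
  also have "\<dots> = right_unit_block a b l"
  proof (rule eq_matI)
    fix i j assume "i < dim_row (right_unit_block a b l)" "j < dim_col (right_unit_block a b l)"
    hence ij: "i < a" "j < b" by auto
    have "(D * (V * M * U)) $$ (i, j) = (\<Sum>k<a. D $$ (i, k) * (V * M * U) $$ (k, j))"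
      by (rule index_mult_mat_sum[OF Dc mult_carrier_mat[OF mult_carrier_mat[OF V(1) M] U(1)] ij])
    also have "\<dots> = (\<Sum>k<a. if k = i then right_unit_block a b l $$ (i, j) else 0)"
      unfolding eq
    proof (rule sum.cong)
      fix k assume "k \<in> {..<a}"
      thus "D $$ (i, k) * mat a b (\<lambda>(i, j). if j = b - l + i \<and> i < l then s i else 0) $$ (k, j) =
          (if k = i then right_unit_block a b l $$ (i, j) else 0)"
        using ij less_imp_neq[OF s[of i]] by (auto simp: D_def)
    qed simp
    also have "\<dots> = right_unit_block a b l $$ (i, j)" using ij by (subst sum.delta) simp_all
    finally show "(D * (V * M * U)) $$ (i, j) = right_unit_block a b l $$ (i, j)" .
  qed (use Dc U in auto)
  finally have "D * V * M * U = right_unit_block a b l" .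
  from that[OF inverse_pair_mult[OF D inverse_pair_orthonormal[OF V]] U l this] show ?thesis .
qed

lemma column_compression:
  fixes M :: "real mat"
  assumes M: "M \<in> carrier_mat a b"
  obtains V Y Yi l where "V \<in> carrier_mat a a" "orthonormal_mat V" "inverse_pair b Y Yi"
    "l \<le> a" "l \<le> b" "V * M * Y = right_unit_block a b l"
proof -
  obtain V U l s where V: "V \<in> carrier_mat a a" "orthonormal_mat V"
    and U: "U \<in> carrier_mat b b" "orthonormal_mat U"
    and l: "l \<le> a" "l \<le> b" and s: "\<And>i. i < l \<Longrightarrow> 0 < s i"
    and eq: "V * M * U = mat a b (\<lambda>(i, j). if j = b - l + i \<and> i < l then s i else 0)"
    by (rule svd_right_aligned[OF M]) (rule that)
  \<comment> \<open>The singular value \<open>s i\<close> sits in column \<open>b - l + i\<close>,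
    whence the index shift.\<close>
  define d where "d j = (if j < b - l then 1 else 1 / s (j - (b - l)))" for j
  define D where "D = mat b b (\<lambda>(i, j). if i = j then d i else 0)"
  have "d i \<noteq> 0" if "i < b" for i
  proof (cases "i < b - l")
    case False
    hence "i - (b - l) < l" using that l by linarith
    thus ?thesis using s[of "i - (b - l)"] False by (simp add: d_def)
  qed (simp add: d_def)
  then obtain Di where D: "inverse_pair b D Di"
    using inverse_pair_diagonal[of b d] unfolding D_def by blast
  have Dc: "D \<in> carrier_mat b b" unfolding D_def by simp
  have "V * M * (U * D) = V * M * U * D"
    by (rule assoc_mult_mat[of _ a b _ b _ b, symmetric]) (use Dc V M U in auto)
  also have "\<dots> = right_unit_block a b l"
  proof (rule eq_matI)
    fix i j assume "i < dim_row (right_unit_block a b l)" "j < dim_col (right_unit_block a b l)"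
    hence ij: "i < a" "j < b" by auto
    have "(V * M * U * D) $$ (i, j) = (\<Sum>k<b. (V * M * U) $$ (i, k) * D $$ (k, j))"
      by (rule index_mult_mat_sum[OF mult_carrier_mat[OF mult_carrier_mat[OF V(1) M] U(1)] Dc ij])
    also have "\<dots> = (\<Sum>k<b. if k = j then right_unit_block a b l $$ (i, j) else 0)"
      unfolding eq
    proof (rule sum.cong)
      fix k assume "k \<in> {..<b}"
      thus "mat a b (\<lambda>(i, j). if j = b - l + i \<and> i < l then s i else 0) $$ (i, k) * D $$ (k, j) =
          (if k = j then right_unit_block a b l $$ (i, j) else 0)"
        using ij less_imp_neq[OF s[of i]] by (auto simp: D_def d_def)
    qed simp
    also have "\<dots> = right_unit_block a b l $$ (i, j)" using ij by (subst sum.delta) simp_all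
    finally show "(V * M * U * D) $$ (i, j) = right_unit_block a b l $$ (i, j)" .
  qed (use Dc V in auto)
  finally have "V * M * (U * D) = right_unit_block a b l" .
  from that[OF V inverse_pair_mult[OF inverse_pair_orthonormal[OF U] D] l this] show ?thesis .
qed

section \<open>Triangular factorizations and block matrices\<close>

declare index_mult_mat(1) [simp del]

lemma index_orthonormal_sum:
  assumes M: "M \<in> carrier_mat n n" "orthonormal_mat M" and ij: "i < n" "j < n"
  shows "(\<Sum>k<n. M $$ (k, i) * M $$ (k, j)) = (if i = j then 1 else 0)"
proof -
  have "(\<Sum>k<n. M $$ (k, i) * M $$ (k, j)) = (\<Sum>k<n. transpose_mat M $$ (i, k) * M $$ (k, j))"
    by (rule sum.cong) (use M ij in simp_all)
  also have "\<dots> = (transpose_mat M * M) $$ (i, j)"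
    by (rule index_mult_mat_sum[OF _ M(1) ij, symmetric]) (use M in simp)
  also have "\<dots> = (if i = j then 1 else 0)"
    unfolding iffD1[OF orthonormal_mat_iff[OF M(1)] M(2)] using ij by simp
  finally show ?thesis .
qed

text \<open>In an orthonormal basis that starts with the normalised first column of
  \<open>M\<close>, all other basis vectors are orthogonal to that column. A zero column is left as
  it is.\<close>

lemma first_column_reduction:
  assumes M: "M \<in> carrier_mat (Suc n) (Suc n)"
  shows "\<exists>W. W \<in> carrier_mat (Suc n) (Suc n) \<and> orthonormal_mat W \<and>
    (\<forall>i<Suc n. i \<noteq> 0 \<longrightarrow> (W * M) $$ (i, 0) = 0)"
proof (cases "(\<Sum>k<Suc n. (M $$ (k, 0))\<^sup>2) = 0")
  case True
  have "M $$ (i, 0) = 0" if "i < Suc n" for i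
    using sum_nonneg_eq_0_iff[of "{..<Suc n}" "\<lambda>k. (M $$ (k, 0))\<^sup>2"] that True
    by (simp del: sum.lessThan_Suc)
  thus ?thesis
    by (intro exI[of _ "1\<^sub>m (Suc n)"]) (use M in \<open>simp add: orthonormal_mat_one\<close>)
next
  case False
  define r where "r = sqrt (\<Sum>k<Suc n. (M $$ (k, 0))\<^sup>2)"
  have "(\<Sum>k<Suc n. (M $$ (k, 0))\<^sup>2) \<ge> 0" by (rule sum_nonneg) simp
  hence r: "r \<noteq> 0" "r\<^sup>2 = (\<Sum>k<Suc n. (M $$ (k, 0))\<^sup>2)"
    using False unfolding r_def by (simp_all del: sum.lessThan_Suc)
  have "(\<Sum>k<Suc n. (M $$ (k, 0) / r)\<^sup>2) = (\<Sum>k<Suc n. (M $$ (k, 0))\<^sup>2) / r\<^sup>2"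
    unfolding power_divide by (rule sum_divide_distrib[symmetric])
  also have "\<dots> = 1" unfolding r(2)[symmetric] using r(1) by simp
  finally have unit: "(\<Sum>k<Suc n. (M $$ (k, 0) / r)\<^sup>2) = 1" .
  obtain H where H: "H \<in> carrier_mat (Suc n) (Suc n)" "orthonormal_mat H"
      "\<And>i. i < Suc n \<Longrightarrow> H $$ (i, 0) = M $$ (i, 0) / r"
    by (rule orthonormal_first_column[OF unit]) (rule that)
  have "(transpose_mat H * M) $$ (i, 0) = 0" if i: "i < Suc n" "i \<noteq> 0" for i
  proof -
    have "(transpose_mat H * M) $$ (i, 0) = (\<Sum>k<Suc n. transpose_mat H $$ (i, k) * M $$ (k, 0))"
      by (rule index_mult_mat_sum[OF _ M i(1)]) (use H(1) in simp_all)
    also have "\<dots> = (\<Sum>k<Suc n. r * (H $$ (k, i) * H $$ (k, 0)))"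
      by (rule sum.cong) (use H(1) H(3) i r(1) in simp_all)
    also have "\<dots> = r * (\<Sum>k<Suc n. H $$ (k, i) * H $$ (k, 0))"
      by (rule sum_distrib_left[symmetric])
    also have "\<dots> = 0"
      unfolding index_orthonormal_sum[OF H(1,2) i(1) zero_less_Suc] using i(2) by simp
    finally show ?thesis .
  qed
  thus ?thesis
    by (intro exI[of _ "transpose_mat H"])
      (use H(1) orthonormal_mat_transpose[OF H(1,2)] in simp)
qed

text \<open>The factor from the induction hypothesis mixes only rows from 1 on, where the first
  column has been cleared already, so these zeros survive.\<close>

lemma qr_decomposition:
  assumes "M \<in> carrier_mat n n"
  shows "\<exists>W. W \<in> carrier_mat n n \<and> orthonormal_mat W \<and> upper_triangular (W * M)"
  using assms
proof (induction n arbitrary: M)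
  case 0
  thus ?case by (intro exI[of _ "1\<^sub>m 0"]) (auto simp: orthonormal_mat_one)
next
  case (Suc n)
  note M = Suc.prems
  obtain W where W: "W \<in> carrier_mat (Suc n) (Suc n)" "orthonormal_mat W"
    and W0: "\<And>i. i < Suc n \<Longrightarrow> i \<noteq> 0 \<Longrightarrow> (W * M) $$ (i, 0) = 0"
    using first_column_reduction[OF M] by blast
  define N where "N = W * M"
  have N: "N \<in> carrier_mat (Suc n) (Suc n)" unfolding N_def by (rule mult_carrier_mat[OF W(1) M])
  obtain W' where W': "W' \<in> carrier_mat n n" "orthonormal_mat W'"
    and tri: "upper_triangular (W' * window 1 1 n n N)"
    using Suc.IH[OF window_carrier[of 1 1 n n N]] by blast
  define E where "E = embed_mat (Suc n) 1 W'"
  have n1: "1 + n \<le> Suc n" by simp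
  have E: "E \<in> carrier_mat (Suc n) (Suc n)" "orthonormal_mat E"
    unfolding E_def using orthonormal_mat_embed[OF W' n1] by simp_all
  have EW: "E * W * M = E * N" unfolding N_def by (rule assoc_mult_mat[OF E(1) W(1) M])
  have "(E * N) $$ (i, j) = 0" if ij: "j < i" "i < Suc n" for i j
  proof -
    have j: "j < Suc n" using ij by simp
    have i: "1 \<le> i \<and> i < 1 + n" using ij by simp
    have eq: "(E * N) $$ (i, j) = (\<Sum>l<n. W' $$ (i - 1, l) * N $$ (1 + l, j))"
      unfolding E_def index_embed_mult[OF W'(1) n1 N ij(2) j] if_P[OF i] ..
    show ?thesis
    proof (cases "j = 0")
      case True
      show ?thesis unfolding eq unfolding True
        by (rule sum.neutral) (use W0 in \<open>auto simp: N_def\<close>)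
    next
      case False
      have lt: "i - 1 < n" "j - 1 < n" "j - 1 < i - 1" using ij False by auto
      have "(W' * window 1 1 n n N) $$ (i - 1, j - 1) = (\<Sum>l<n. W' $$ (i - 1, l) * window 1 1 n n N $$ (l, j - 1))"
        by (rule index_mult_mat_sum[OF W'(1) window_carrier lt(1,2)])
      also have "\<dots> = (E * N) $$ (i, j)"
        unfolding eq by (rule sum.cong) (use lt False in simp_all)
      finally have "(E * N) $$ (i, j) = (W' * window 1 1 n n N) $$ (i - 1, j - 1)" ..
      also have "\<dots> = 0" by (rule upper_triangularD[OF tri lt(3)]) (use W'(1) lt(1) in simp)
      finally show ?thesis .
    qed
  qed
  hence "upper_triangular (E * W * M)" unfolding EW using E(1) by (intro upper_triangularI) simp
  thus ?case
    using mult_carrier_mat[OF E(1) W(1)] orthonormal_mat_mult[OF E(1) W(1) E(2) W(2)] by blast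
qed

text \<open>Transposition across the antidiagonal preserves upper triangularity and reverses products,
  so it turns a QR into an RQ decomposition.\<close>

lemma rq_decomposition:
  assumes M: "M \<in> carrier_mat n n"
  shows "\<exists>W. W \<in> carrier_mat n n \<and> orthonormal_mat W \<and> upper_triangular (M * W)"
proof -
  define flip where "flip A = mat n n (\<lambda>(i, j). A $$ (n - Suc j, n - Suc i))" for A :: "real mat"
  have flip: "flip A \<in> carrier_mat n n" for A unfolding flip_def by simp
  obtain W where W: "W \<in> carrier_mat n n" "orthonormal_mat W" and tri: "upper_triangular (W * flip M)"
    using qr_decomposition[OF flip] by blast
  \<comment> \<open>Inner products of columns of \<open>flip W\<close> are inner products of rows of
    \<open>W\<close> summed in reverse order, so orthonormality of the transpose of \<open>W\<close>
    is what enters.\<close>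
  have "transpose_mat (flip W) * flip W = 1\<^sub>m n"
  proof (rule eq_matI)
    fix i j assume "i < dim_row (1\<^sub>m n :: real mat)" "j < dim_col (1\<^sub>m n :: real mat)"
    hence ij: "i < n" "j < n" by auto
    have ij': "n - Suc i < n" "n - Suc j < n" using ij by auto
    have "(transpose_mat (flip W) * flip W) $$ (i, j)
        = (\<Sum>k<n. transpose_mat (flip W) $$ (i, k) * flip W $$ (k, j))"
      by (rule index_mult_mat_sum[OF _ flip ij]) (use flip in simp)
    also have "\<dots> = (\<Sum>k<n. transpose_mat W $$ (n - Suc k, n - Suc i) * transpose_mat W $$ (n - Suc k, n - Suc j))"
      by (rule sum.cong) (use ij W(1) flip[of W] in \<open>simp_all add: flip_def\<close>)
    also have "\<dots> = (\<Sum>k<n. transpose_mat W $$ (k, n - Suc i) * transpose_mat W $$ (k, n - Suc j))"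
      by (rule sum.nat_diff_reindex)
    also have "\<dots> = (if n - Suc i = n - Suc j then 1 else 0)"
      by (rule index_orthonormal_sum[OF _ orthonormal_mat_transpose[OF W] ij']) (use W in simp)
    also have "\<dots> = 1\<^sub>m n $$ (i, j)" using ij by auto
    finally show "(transpose_mat (flip W) * flip W) $$ (i, j) = 1\<^sub>m n $$ (i, j)" .
  qed (use flip[of W] in simp_all)
  hence "orthonormal_mat (flip W)" unfolding orthonormal_mat_iff[OF flip] .
  moreover have "upper_triangular (M * flip W)"
  proof (rule upper_triangularI)
    fix i j assume "j < i" "i < dim_row (M * flip W)"
    hence ij: "j < i" "i < n" "j < n" using M by auto
    have ij': "n - Suc j < n" "n - Suc i < n" "n - Suc i < n - Suc j" using ij by auto
    have "(M * flip W) $$ (i, j) = (\<Sum>k<n. M $$ (i, k) * flip W $$ (k, j))"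
      by (rule index_mult_mat_sum[OF M flip ij(2,3)])
    also have "\<dots> = (\<Sum>k<n. W $$ (n - Suc j, n - Suc k) * flip M $$ (n - Suc k, n - Suc i))"
      by (rule sum.cong) (use ij in \<open>simp_all add: flip_def\<close>)
    also have "\<dots> = (\<Sum>k<n. W $$ (n - Suc j, k) * flip M $$ (k, n - Suc i))"
      by (rule sum.nat_diff_reindex)
    also have "\<dots> = (W * flip M) $$ (n - Suc j, n - Suc i)"
      by (rule index_mult_mat_sum[OF W(1) flip ij'(1,2), symmetric])
    also have "\<dots> = 0" by (rule upper_triangularD[OF tri ij'(3)]) (use W(1) ij' in simp)
    finally show "(M * flip W) $$ (i, j) = 0" .
  qed
  ultimately show ?thesis using flip by blast
qed

section \<open>Invertible triangular matrices\<close>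

lemma triangular_inverse_pair:
  fixes M :: "real mat"
  assumes M: "M \<in> carrier_mat n n" "upper_triangular M" and diag: "\<And>i. i < n \<Longrightarrow> M $$ (i, i) \<noteq> 0"
  obtains N where "inverse_pair n M N"
proof -
  have "0 \<notin> set (diag_mat M)" using M(1) diag by (auto simp: diag_mat_def)
  hence "det M \<noteq> 0" using upper_triangular_imp_det_eq_0_iff[OF M] by blast
  from det_non_zero_imp_unit[OF M(1) this, of undefined]
  obtain N where "N \<in> carrier_mat n n" "N * M = 1\<^sub>m n" "M * N = 1\<^sub>m n"
    unfolding Units_def ring_mat_def by auto
  from that[OF inverse_pairI[OF M(1) this(1,3)]] show ?thesis .
qed

text \<open>The determinant is nonzero and is the product of the diagonal entries.\<close>

lemma inverse_pair_triangular_diag: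
  assumes MN: "inverse_pair n M N" and tri: "upper_triangular M" and i: "i < n"
  shows "M $$ (i, i) \<noteq> 0"
proof -
  have M: "M \<in> carrier_mat n n" and N: "N \<in> carrier_mat n n" and eq: "M * N = 1\<^sub>m n"
    using MN unfolding inverse_pair_def by auto
  have "det M * det N = 1" using det_mult[OF M N] unfolding eq by simp
  hence "det M \<noteq> 0" by auto
  hence "0 \<notin> set (diag_mat M)" using upper_triangular_imp_det_eq_0_iff[OF M tri] by blast
  moreover have "M $$ (i, i) \<in> set (diag_mat M)" using M i by (simp add: diag_mat_def)
  ultimately show ?thesis by metis
qed

lemma inverse_pair_invertible: "inverse_pair n M N \<Longrightarrow> invertible_mat M"
  unfolding inverse_pair_def invertible_mat_def inverts_mat_def by auto

section \<open>Cutting a matrix into blocks\<close>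

lemma window_append_cols:
  "window d e r c M @\<^sub>c window d (e + c) r c' M = window d e r (c + c') M"
proof (rule eq_matI)
  fix i j assume "i < dim_row (window d e r (c + c') M)" "j < dim_col (window d e r (c + c') M)"
  hence ij: "i < r" "j < c + c'" by auto
  show "(window d e r c M @\<^sub>c window d (e + c) r c' M) $$ (i, j) = window d e r (c + c') M $$ (i, j)"
    unfolding index_append_cols[OF window_carrier window_carrier ij] using ij by (simp add: add.assoc)
qed (simp_all add: append_cols_def)

lemma window_append_rows:
  "window d e r c M @\<^sub>r window (d + r) e r' c M = window d e (r + r') c M"
  by (rule eq_matI) (auto simp: append_rows_def add.assoc)

text \<open>Together with \<open>window_rows\<close> this recovers from a matrix the lists of blocks
  that \<open>block_row\<close> and \<open>block_mat\<close> put together.\<close>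

fun window_row :: "nat \<Rightarrow> nat \<Rightarrow> nat \<Rightarrow> nat list \<Rightarrow> real mat \<Rightarrow> real mat list" where
  "window_row d e r [] M = []"
| "window_row d e r (c # cs) M = window d e r c M # window_row d (e + c) r cs M"

fun window_rows :: "nat \<Rightarrow> nat list \<Rightarrow> nat list \<Rightarrow> real mat \<Rightarrow> real mat list list" where
  "window_rows d [] cs M = []"
| "window_rows d (r # rs) cs M = window_row d 0 r cs M # window_rows (d + r) rs cs M"

lemma block_row_windows: "block_row r (window_row d e r cs M) = window d e r (sum_list cs) M"
proof (induction cs arbitrary: e)
  case Nil
  show ?case by (rule eq_matI) simp_all
qed (simp add: window_append_cols)

lemma block_mat_windows:
  "block_mat rs (sum_list cs) (window_rows d rs cs M) = window d 0 (sum_list rs) (sum_list cs) M"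
proof (induction rs arbitrary: d)
  case Nil
  show ?case by (rule eq_matI) simp_all
qed (simp add: block_row_windows window_append_rows)

text \<open>Reduces the proof of a block form to the question which windows vanish.\<close>

lemma block_mat_windows_all:
  assumes "M \<in> carrier_mat (sum_list rs) (sum_list cs)"
  shows "M = block_mat rs (sum_list cs) (window_rows 0 rs cs M)"
  unfolding block_mat_windows by (rule eq_matI) (use assms in simp_all)

section \<open>The restricted singular value form\<close>

text \<open>\<open>X\<close> is shared by A and B, and \<open>Y\<close> by A and C. These two are
  merely invertible because triangular factors repair them at the end; nothing acts on
  \<open>U\<close> and \<open>V\<close> later, so they are orthonormal from the start.\<close>

definition simul_equiv :: "nat \<Rightarrow> nat \<Rightarrow> nat \<Rightarrow> nat \<Rightarrow>
    real mat \<Rightarrow> real mat \<Rightarrow> real mat \<Rightarrow> real mat \<Rightarrow> real mat \<Rightarrow> real mat \<Rightarrow> bool" where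
  "simul_equiv p q m n A B C A' B' C' \<longleftrightarrow>
    (\<exists>X Xi Y Yi U V. inverse_pair p X Xi \<and> inverse_pair q Y Yi \<and>
      U \<in> carrier_mat m m \<and> orthonormal_mat U \<and> V \<in> carrier_mat n n \<and> orthonormal_mat V \<and>
      A' = X * A * Y \<and> B' = X * B * U \<and> C' = V * C * Y)"

lemma simul_equivI:
  assumes "inverse_pair p X Xi" "inverse_pair q Y Yi" "U \<in> carrier_mat m m" "orthonormal_mat U"
    "V \<in> carrier_mat n n" "orthonormal_mat V" "A' = X * A * Y" "B' = X * B * U" "C' = V * C * Y"
  shows "simul_equiv p q m n A B C A' B' C'"
  unfolding simul_equiv_def using assms by blast

lemma simul_equiv_carrier:
  assumes "simul_equiv p q m n A B C A' B' C'"
  shows "A' \<in> carrier_mat p q" "B' \<in> carrier_mat p m" "C' \<in> carrier_mat n q"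
  using assms unfolding simul_equiv_def inverse_pair_def by auto

lemma simul_equiv_trans:
  assumes A: "A \<in> carrier_mat p q" and B: "B \<in> carrier_mat p m" and C: "C \<in> carrier_mat n q"
    and e1: "simul_equiv p q m n A B C A' B' C'" and e2: "simul_equiv p q m n A' B' C' A'' B'' C''"
  shows "simul_equiv p q m n A B C A'' B'' C''"
proof -
  obtain X Xi Y Yi U V where 1: "inverse_pair p X Xi" "inverse_pair q Y Yi"
    "U \<in> carrier_mat m m" "orthonormal_mat U" "V \<in> carrier_mat n n" "orthonormal_mat V"
    "A' = X * A * Y" "B' = X * B * U" "C' = V * C * Y"
    using e1 unfolding simul_equiv_def by blast
  obtain X2 Xi2 Y2 Yi2 U2 V2 where 2: "inverse_pair p X2 Xi2" "inverse_pair q Y2 Yi2"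
    "U2 \<in> carrier_mat m m" "orthonormal_mat U2" "V2 \<in> carrier_mat n n" "orthonormal_mat V2"
    "A'' = X2 * A' * Y2" "B'' = X2 * B' * U2" "C'' = V2 * C' * Y2"
    using e2 unfolding simul_equiv_def by blast
  have X: "X \<in> carrier_mat p p" "X2 \<in> carrier_mat p p" and Y: "Y \<in> carrier_mat q q" "Y2 \<in> carrier_mat q q"
    using 1(1,2) 2(1,2) unfolding inverse_pair_def by blast+
  show ?thesis
  proof (rule simul_equivI)
    show "A'' = (X2 * X) * A * (Y * Y2)" unfolding 2(7) 1(7) by (rule mat_mult_regroup[OF X(2,1) A Y, symmetric])
    show "B'' = (X2 * X) * B * (U * U2)" unfolding 2(8) 1(8) by (rule mat_mult_regroup[OF X(2,1) B 1(3) 2(3), symmetric])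
    show "C'' = (V2 * V) * C * (Y * Y2)" unfolding 2(9) 1(9) by (rule mat_mult_regroup[OF 2(5) 1(5) C Y, symmetric])
  qed (rule inverse_pair_mult[OF 2(1) 1(1)] inverse_pair_mult[OF 1(2) 2(2)] mult_carrier_mat[OF 1(3) 2(3)]
      mult_carrier_mat[OF 2(5) 1(5)] orthonormal_mat_mult[OF 1(3) 2(3) 1(4) 2(4)]
      orthonormal_mat_mult[OF 2(5) 1(5) 2(6) 1(6)])+
qed

text \<open>Row i < r faces column a + i. This correspondence translates an action on rows of B into
  one on columns of C.\<close>

definition unit_diagonal :: "nat \<Rightarrow> nat \<Rightarrow> nat \<Rightarrow> nat \<Rightarrow> real mat" where
  "unit_diagonal p q a r = mat p q (\<lambda>(i, j). if j = a + i \<and> i < r then 1 else 0)"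

lemma unit_diagonal_carrier: "unit_diagonal p q a r \<in> carrier_mat p q"
  unfolding unit_diagonal_def by simp

lemma index_unit_diagonal:
  "i < p \<Longrightarrow> j < q \<Longrightarrow> unit_diagonal p q a r $$ (i, j) = (if j = a + i \<and> i < r then 1 else 0)"
  unfolding unit_diagonal_def by simp

lemma embed_two_sided_outside:
  assumes X: "X \<in> carrier_mat r r" "d + r \<le> p" and U: "U \<in> carrier_mat c c" "e + c \<le> m"
    and B: "B \<in> carrier_mat p m" and ij: "i < p" "j < m"
    and out: "\<not> (d \<le> i \<and> i < d + r)" "\<not> (e \<le> j \<and> j < e + c)"
  shows "(embed_mat p d X * B * embed_mat m e U) $$ (i, j) = B $$ (i, j)"
  unfolding index_mult_embed[OF U mult_carrier_mat[OF embed_mat_carrier B] ij] if_not_P[OF out(2)]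
    index_embed_mult[OF X B ij] if_not_P[OF out(1)] ..

text \<open>The entry is a combination of entries of \<open>B\<close> in the rows that the left
  factor mixes with row \<open>i\<close> and the columns that the right factor mixes with column
  \<open>j\<close>; the two conditional premises describe exactly these.\<close>

lemma embed_two_sided_zero:
  assumes X: "X \<in> carrier_mat r r" "d + r \<le> p" and U: "U \<in> carrier_mat c c" "e + c \<le> m"
    and B: "B \<in> carrier_mat p m" and ij: "i < p" "j < m"
    and zero: "\<And>i' j'. i' < p \<Longrightarrow> j' < m \<Longrightarrow>
      (if d \<le> i \<and> i < d + r then d \<le> i' \<and> i' < d + r else i' = i) \<Longrightarrow>
      (if e \<le> j \<and> j < e + c then e \<le> j' \<and> j' < e + c else j' = j) \<Longrightarrow> B $$ (i', j') = 0"
  shows "(embed_mat p d X * B * embed_mat m e U) $$ (i, j) = 0"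
proof -
  have row: "(embed_mat p d X * B) $$ (i, j') = 0"
    if j': "j' < m" "if e \<le> j \<and> j < e + c then e \<le> j' \<and> j' < e + c else j' = j" for j'
  proof (cases "d \<le> i \<and> i < d + r")
    case True
    have "(\<Sum>l<r. X $$ (i - d, l) * B $$ (d + l, j')) = 0"
    proof (rule sum.neutral, rule ballI)
      fix l assume "l \<in> {..<r}"
      hence l: "l < r" by simp
      have "B $$ (d + l, j') = 0"
      proof (rule zero[OF _ j'(1) _ j'(2)])
        show "d + l < p" using l X(2) by linarith
        show "if d \<le> i \<and> i < d + r then d \<le> d + l \<and> d + l < d + r else d + l = i"
          unfolding if_P[OF True] using l by simp
      qed
      thus "X $$ (i - d, l) * B $$ (d + l, j') = 0" by simp
    qed
    thus ?thesis unfolding index_embed_mult[OF X B ij(1) j'(1)] if_P[OF True] .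
  next
    case False
    have "B $$ (i, j') = 0"
      by (rule zero[OF ij(1) j'(1) _ j'(2)]) (simp only: if_not_P[OF False])
    thus ?thesis unfolding index_embed_mult[OF X B ij(1) j'(1)] if_not_P[OF False] .
  qed
  note eq = index_mult_embed[OF U mult_carrier_mat[OF embed_mat_carrier B] ij, of d X]
  show ?thesis
  proof (cases "e \<le> j \<and> j < e + c")
    case True
    have "(\<Sum>l<c. (embed_mat p d X * B) $$ (i, e + l) * U $$ (l, j - e)) = 0"
    proof (rule sum.neutral, rule ballI)
      fix l assume "l \<in> {..<c}"
      hence l: "l < c" by simp
      have "(embed_mat p d X * B) $$ (i, e + l) = 0"
      proof (rule row)
        show "e + l < m" using l U(2) by linarith
        show "if e \<le> j \<and> j < e + c then e \<le> e + l \<and> e + l < e + c else e + l = j"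
          unfolding if_P[OF True] using l by simp
      qed
      thus "(embed_mat p d X * B) $$ (i, e + l) * U $$ (l, j - e) = 0" by simp
    qed
    thus ?thesis unfolding eq if_P[OF True] .
  next
    case False
    have "(embed_mat p d X * B) $$ (i, j) = 0"
      by (rule row[OF ij(2)]) (simp only: if_not_P[OF False])
    thus ?thesis unfolding eq if_not_P[OF False] .
  qed
qed

lemma embed_two_sided_inside:
  assumes X: "X \<in> carrier_mat r r" "d + r \<le> p" and U: "U \<in> carrier_mat c c" "e + c \<le> m"
    and B: "B \<in> carrier_mat p m" and ij: "i < r" "j < c"
  shows "(embed_mat p d X * B * embed_mat m e U) $$ (d + i, e + j) = (X * window d e r c B * U) $$ (i, j)"
  unfolding window_embed_mult[OF X(1) U(1) B X(2) U(2), symmetric] index_window[OF ij] ..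

text \<open>As row i faces column a + i, a block at row offset \<open>d\<close> passes through the
  units to column offset \<open>a + d\<close>. The bound \<open>d + k \<le> r\<close> keeps it
  within the units.\<close>

lemma embed_unit_diagonal_commute:
  assumes Z: "Z \<in> carrier_mat k k" and d: "d + k \<le> r" and r: "r \<le> p" "a + r \<le> q"
  shows "embed_mat p d Z * unit_diagonal p q a r = unit_diagonal p q a r * embed_mat q (a + d) Z"
proof (rule eq_matI)
  let ?E = "unit_diagonal p q a r"
  note E = unit_diagonal_carrier[of p q a r]
  have dp: "d + k \<le> p" and dq: "a + d + k \<le> q" using d r by auto
  fix i j assume "i < dim_row (?E * embed_mat q (a + d) Z)" "j < dim_col (?E * embed_mat q (a + d) Z)"
  hence ij: "i < p" "j < q" by (auto simp: unit_diagonal_def)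
  have left: "(\<Sum>l<k. Z $$ (i - d, l) * ?E $$ (d + l, j)) =
      (if a + d \<le> j \<and> j < a + d + k then Z $$ (i - d, j - (a + d)) else 0)"
  proof (cases "a + d \<le> j \<and> j < a + d + k")
    case True
    have "(\<Sum>l<k. Z $$ (i - d, l) * ?E $$ (d + l, j)) = (\<Sum>l<k. if l = j - (a + d) then Z $$ (i - d, j - (a + d)) else 0)"
    proof (rule sum.cong)
      fix l assume "l \<in> {..<k}"
      hence "d + l < p" "d + l < r" using dp d by auto
      thus "Z $$ (i - d, l) * ?E $$ (d + l, j) = (if l = j - (a + d) then Z $$ (i - d, j - (a + d)) else 0)"
        using ij True by (auto simp: index_unit_diagonal)
    qed simp
    also have "\<dots> = Z $$ (i - d, j - (a + d))" using True by (subst sum.delta) auto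
    finally show ?thesis unfolding if_P[OF True] .
  next
    case False
    have "(\<Sum>l<k. Z $$ (i - d, l) * ?E $$ (d + l, j)) = 0"
    proof (rule sum.neutral, rule ballI)
      fix l assume "l \<in> {..<k}"
      hence "d + l < p" "j \<noteq> a + (d + l)" using dp False by auto
      thus "Z $$ (i - d, l) * ?E $$ (d + l, j) = 0" using ij by (simp add: index_unit_diagonal)
    qed
    thus ?thesis unfolding if_not_P[OF False] .
  qed
  have right: "(\<Sum>l<k. ?E $$ (i, a + d + l) * Z $$ (l, j - (a + d))) =
      (if d \<le> i \<and> i < d + k then Z $$ (i - d, j - (a + d)) else 0)"
  proof (cases "d \<le> i \<and> i < d + k")
    case True
    have "(\<Sum>l<k. ?E $$ (i, a + d + l) * Z $$ (l, j - (a + d))) = (\<Sum>l<k. if l = i - d then Z $$ (i - d, j - (a + d)) else 0)"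
    proof (rule sum.cong)
      fix l assume "l \<in> {..<k}"
      hence "a + d + l < q" using dq by auto
      thus "?E $$ (i, a + d + l) * Z $$ (l, j - (a + d)) = (if l = i - d then Z $$ (i - d, j - (a + d)) else 0)"
        using ij True d by (auto simp: index_unit_diagonal)
    qed simp
    also have "\<dots> = Z $$ (i - d, j - (a + d))" using True by (subst sum.delta) auto
    finally show ?thesis unfolding if_P[OF True] .
  next
    case False
    have "(\<Sum>l<k. ?E $$ (i, a + d + l) * Z $$ (l, j - (a + d))) = 0"
    proof (rule sum.neutral, rule ballI)
      fix l assume "l \<in> {..<k}"
      hence "a + d + l < q" "a + d + l \<noteq> a + i" using dq False by auto
      thus "?E $$ (i, a + d + l) * Z $$ (l, j - (a + d)) = 0" using ij by (simp add: index_unit_diagonal)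
    qed
    thus ?thesis unfolding if_not_P[OF False] .
  qed
  have "?E $$ (i, j) = 0" if "(d \<le> i \<and> i < d + k) \<noteq> (a + d \<le> j \<and> j < a + d + k)"
    using that ij by (auto simp: index_unit_diagonal)
  thus "(embed_mat p d Z * ?E) $$ (i, j) = (?E * embed_mat q (a + d) Z) $$ (i, j)"
    unfolding index_embed_mult[OF Z dp E ij] index_mult_embed[OF Z dq E ij] left right
    by (cases "d \<le> i \<and> i < d + k"; cases "a + d \<le> j \<and> j < a + d + k") auto
qed (auto simp: unit_diagonal_def)

lemma embed_unit_diagonal:
  assumes Z: "inverse_pair k Z Zi" and d: "d + k \<le> r" and r: "r \<le> p" "a + r \<le> q"
  shows "embed_mat p d Z * unit_diagonal p q a r * embed_mat q (a + d) Zi = unit_diagonal p q a r"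
proof -
  have Zc: "Z \<in> carrier_mat k k" using Z unfolding inverse_pair_def by blast
  have dq: "a + d + k \<le> q" using d r by simp
  have "unit_diagonal p q a r * embed_mat q (a + d) Z * embed_mat q (a + d) Zi
      = unit_diagonal p q a r * (embed_mat q (a + d) Z * embed_mat q (a + d) Zi)"
    by (rule assoc_mult_mat[OF unit_diagonal_carrier embed_mat_carrier embed_mat_carrier])
  also have "embed_mat q (a + d) Z * embed_mat q (a + d) Zi = 1\<^sub>m q"
    using inverse_pair_embed[OF Z dq] unfolding inverse_pair_def by blast
  finally show ?thesis
    unfolding embed_unit_diagonal_commute[OF Zc d r] right_mult_one_mat[OF unit_diagonal_carrier] .
qed

text \<open>Common shape of the last three reductions. \<open>U\<close> acts on the first columns of
  B and \<open>V\<close> on rows of C from \<open>t\<close> on, because in the applications the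
  parts reduced earlier are zero there.\<close>

lemma simul_equiv_block_step:
  assumes Z: "inverse_pair k Z Zi" and d: "d + k \<le> r" and r: "r \<le> p" "a + r \<le> q"
    and U: "U \<in> carrier_mat c c" "orthonormal_mat U" "c \<le> m"
    and V: "V \<in> carrier_mat b b" "orthonormal_mat V" "t + b \<le> n"
  shows "simul_equiv p q m n (unit_diagonal p q a r) B C (unit_diagonal p q a r)
    (embed_mat p d Z * B * embed_mat m 0 U) (embed_mat n t V * C * embed_mat q (a + d) Zi)"
proof (rule simul_equivI)
  show "inverse_pair p (embed_mat p d Z) (embed_mat p d Zi)"
    by (rule inverse_pair_embed[OF Z]) (use d r in simp)
  show "inverse_pair q (embed_mat q (a + d) Zi) (embed_mat q (a + d) Z)"
    by (rule inverse_pair_embed[OF inverse_pair_sym[OF Z]]) (use d r in simp)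
  show "orthonormal_mat (embed_mat m 0 U)" by (rule orthonormal_mat_embed[OF U(1,2)]) (use U(3) in simp)
  show "orthonormal_mat (embed_mat n t V)" by (rule orthonormal_mat_embed[OF V])
  show "unit_diagonal p q a r = embed_mat p d Z * unit_diagonal p q a r * embed_mat q (a + d) Zi"
    by (rule embed_unit_diagonal[OF Z d r, symmetric])
qed simp_all


text \<open>Each of the five predicates fixes one window and leaves all other entries free. For B
  the windows are the rows from \<open>r\<close> on, the rows from \<open>r - k\<close> to
  \<open>r\<close> left of the last \<open>s\<close> columns, and the top rows left of the last
  \<open>s + l\<close> columns; for C the first \<open>a\<close> columns, and the rows from
  \<open>t\<close> on in the last \<open>r\<close> columns.\<close>

definition bottom_reduced :: "nat \<Rightarrow> nat \<Rightarrow> nat \<Rightarrow> nat \<Rightarrow> real mat \<Rightarrow> bool" where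
  "bottom_reduced p m r s B \<longleftrightarrow> (\<forall>i<p - r. \<forall>j<m. B $$ (r + i, j) = (if j = m - s + i \<and> i < s then 1 else 0))"

definition left_reduced :: "nat \<Rightarrow> nat \<Rightarrow> nat \<Rightarrow> real mat \<Rightarrow> bool" where
  "left_reduced n a t C \<longleftrightarrow> (\<forall>i<n. \<forall>j<a. C $$ (i, j) = (if j = a - t + i \<and> i < t then 1 else 0))"

definition corner_reduced :: "nat \<Rightarrow> nat \<Rightarrow> nat \<Rightarrow> nat \<Rightarrow> nat \<Rightarrow> real mat \<Rightarrow> bool" where
  "corner_reduced n a r t k C \<longleftrightarrow>
    (\<forall>i<n - t. \<forall>j<r. C $$ (t + i, a + j) = (if j = r - k + i \<and> i < k then 1 else 0))"

definition middle_reduced :: "nat \<Rightarrow> nat \<Rightarrow> nat \<Rightarrow> nat \<Rightarrow> (nat \<Rightarrow> real) \<Rightarrow> real mat \<Rightarrow> bool" where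
  "middle_reduced r k c l \<sigma> B \<longleftrightarrow>
    (\<forall>i<k. \<forall>j<c. B $$ (r - k + i, j) = (if j = c - l + i \<and> i < l then \<sigma> i else 0))"

definition top_reduced :: "nat \<Rightarrow> nat \<Rightarrow> nat \<Rightarrow> real mat \<Rightarrow> bool" where
  "top_reduced d c h B \<longleftrightarrow>
    (\<forall>i<d. \<forall>j<c. B $$ (i, j) = (if j = c - h + i \<and> i < h then 1 else 0))"

section \<open>The successive reductions\<close>

lemma reduce_A:
  assumes A: "A \<in> carrier_mat p q"
  shows "\<exists>r B' C'. r \<le> p \<and> r \<le> q \<and> simul_equiv p q m n A B C (unit_diagonal p q (q - r) r) B' C'"
proof -
  obtain X Xi U r where X: "inverse_pair p X Xi" and U: "U \<in> carrier_mat q q" "orthonormal_mat U"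
    and r: "r \<le> p" "r \<le> q" and eq: "X * A * U = right_unit_block p q r"
    by (rule row_compression[OF A]) (rule that)
  have "simul_equiv p q m n A B C (unit_diagonal p q (q - r) r) (X * B * 1\<^sub>m m) (1\<^sub>m n * C * U)"
    by (rule simul_equivI[OF X inverse_pair_orthonormal[OF U] one_carrier_mat orthonormal_mat_one
          one_carrier_mat orthonormal_mat_one _ refl refl])
      (simp only: eq unit_diagonal_def)
  thus ?thesis using r by blast
qed

text \<open>The rows from \<open>r\<close> on and the columns before \<open>a\<close> of the shifted
  identity are zero, so \<open>X\<close> and \<open>Y\<close> acting there can be chosen
  independently of each other.\<close>

lemma reduce_B_bottom_C_left:
  assumes B: "B \<in> carrier_mat p m" and C: "C \<in> carrier_mat n q" and r: "r \<le> p" "a + r = q"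
  shows "\<exists>s t B' C'. s \<le> p - r \<and> s \<le> m \<and> t \<le> n \<and> t \<le> a \<and>
    simul_equiv p q m n (unit_diagonal p q a r) B C (unit_diagonal p q a r) B' C' \<and>
    bottom_reduced p m r s B' \<and> left_reduced n a t C'"
proof -
  obtain X Xi U s where X: "inverse_pair (p - r) X Xi" and U: "U \<in> carrier_mat m m" "orthonormal_mat U"
    and s: "s \<le> p - r" "s \<le> m" and eqB: "X * window r 0 (p - r) m B * U = right_unit_block (p - r) m s"
    by (rule row_compression[OF window_carrier[of r 0 "p - r" m B]]) (rule that)
  obtain V Y Yi t where V: "V \<in> carrier_mat n n" "orthonormal_mat V" and Y: "inverse_pair a Y Yi"
    and t: "t \<le> n" "t \<le> a" and eqC: "V * window 0 0 n a C * Y = right_unit_block n a t"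
    by (rule column_compression[OF window_carrier[of 0 0 n a C]]) (rule that)
  have Xc: "X \<in> carrier_mat (p - r) (p - r)" and Yc: "Y \<in> carrier_mat a a"
    using X Y unfolding inverse_pair_def by blast+
  have dX: "r + (p - r) \<le> p" and dY: "0 + a \<le> q" and dU: "0 + m \<le> m" and dV: "0 + n \<le> n" using r by auto
  let ?E = "unit_diagonal p q a r"
  note E = unit_diagonal_carrier[of p q a r]
  define B' where "B' = embed_mat p r X * B * embed_mat m 0 U"
  define C' where "C' = embed_mat n 0 V * C * embed_mat q 0 Y"
  have "embed_mat p r X * ?E * embed_mat q 0 Y = ?E"
  proof (rule eq_matI)
    fix i j assume "i < dim_row ?E" "j < dim_col ?E"
    hence ij: "i < p" "j < q" using E by auto
    show "(embed_mat p r X * ?E * embed_mat q 0 Y) $$ (i, j) = ?E $$ (i, j)"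
    proof (cases "i < r \<and> a \<le> j")
      case True
      show ?thesis by (rule embed_two_sided_outside[OF Xc dX Yc dY E ij]) (use True in auto)
    next
      case False
      have "(embed_mat p r X * ?E * embed_mat q 0 Y) $$ (i, j) = 0"
        by (rule embed_two_sided_zero[OF Xc dX Yc dY E ij])
          (use False ij in \<open>auto simp: index_unit_diagonal split: if_splits\<close>)
      also have "0 = ?E $$ (i, j)" using False ij by (auto simp: index_unit_diagonal)
      finally show ?thesis .
    qed
  qed (auto simp: unit_diagonal_def)
  hence "simul_equiv p q m n ?E B C ?E B' C'"
    by (intro simul_equivI[OF inverse_pair_embed[OF X dX] inverse_pair_embed[OF Y dY]
        embed_mat_carrier orthonormal_mat_embed[OF U dU] embed_mat_carrier orthonormal_mat_embed[OF V dV]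
        _ B'_def C'_def]) (rule sym)
  moreover have "bottom_reduced p m r s B'"
    unfolding bottom_reduced_def
  proof (intro allI impI)
    fix i j assume ij: "i < p - r" "j < m"
    have "B' $$ (r + i, j) = right_unit_block (p - r) m s $$ (i, j)"
      using embed_two_sided_inside[OF Xc dX U(1) dU B ij] unfolding B'_def eqB by simp
    thus "B' $$ (r + i, j) = (if j = m - s + i \<and> i < s then 1 else 0)" using ij by simp
  qed
  moreover have "left_reduced n a t C'"
    unfolding left_reduced_def
  proof (intro allI impI)
    fix i j assume ij: "i < n" "j < a"
    have "C' $$ (i, j) = right_unit_block n a t $$ (i, j)"
      using embed_two_sided_inside[OF V(1) dV Yc dY C ij] unfolding C'_def eqC by simp
    thus "C' $$ (i, j) = (if j = a - t + i \<and> i < t then 1 else 0)" using ij by simp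
  qed
  ultimately show ?thesis using s t by blast
qed

text \<open>The empty block, whose embedding is the identity; it stands for \<open>U\<close> or
  \<open>V\<close> in a step that leaves that side alone.\<close>

lemma one_mat_0_orthonormal: "1\<^sub>m 0 \<in> carrier_mat 0 0" "orthonormal_mat (1\<^sub>m 0)"
  by (simp_all add: orthonormal_mat_one)

lemma bottom_reducedD:
  assumes "bottom_reduced p m r s B" "r \<le> i" "i < p" "j < m"
  shows "B $$ (i, j) = (if j = m - s + (i - r) \<and> i - r < s then 1 else 0)"
proof -
  have "i - r < p - r" using assms(2,3) by linarith
  hence "B $$ (r + (i - r), j) = (if j = m - s + (i - r) \<and> i - r < s then 1 else 0)"
    using assms(1,4) unfolding bottom_reduced_def by blast
  thus ?thesis unfolding le_add_diff_inverse[OF assms(2)] .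
qed

lemma corner_reducedD:
  assumes "corner_reduced n a r t k C" "t \<le> i" "i < n" "a \<le> j" "j < a + r"
  shows "C $$ (i, j) = (if j - a = r - k + (i - t) \<and> i - t < k then 1 else 0)"
proof -
  have "i - t < n - t" "j - a < r" using assms(2-5) by linarith+
  hence "C $$ (t + (i - t), a + (j - a)) = (if j - a = r - k + (i - t) \<and> i - t < k then 1 else 0)"
    using assms(1) unfolding corner_reduced_def by blast
  thus ?thesis unfolding le_add_diff_inverse[OF assms(2)] le_add_diff_inverse[OF assms(4)] .
qed

lemma middle_reducedD:
  assumes "middle_reduced r k c l \<sigma> B" "r - k \<le> i" "i < r" "j < c"
  shows "B $$ (i, j) = (if j = c - l + (i - (r - k)) \<and> i - (r - k) < l then \<sigma> (i - (r - k)) else 0)"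
proof -
  have "i - (r - k) < k" using assms(2,3) by linarith
  hence "B $$ (r - k + (i - (r - k)), j) =
      (if j = c - l + (i - (r - k)) \<and> i - (r - k) < l then \<sigma> (i - (r - k)) else 0)"
    using assms(1,4) unfolding middle_reduced_def by blast
  thus ?thesis unfolding le_add_diff_inverse[OF assms(2)] .
qed

text \<open>\<open>V\<close> mixes only rows from \<open>t\<close> on, which are zero in the first
  \<open>a\<close> columns, and \<open>Y\<close> mixes only columns outside these.\<close>

lemma left_reduced_step:
  assumes left: "left_reduced n a t C" and C: "C \<in> carrier_mat n q"
    and V: "V \<in> carrier_mat b b" "t + b \<le> n" and Y: "Y \<in> carrier_mat c c" "a + d + c \<le> q" and a: "a \<le> q"
  shows "left_reduced n a t (embed_mat n t V * C * embed_mat q (a + d) Y)"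
  unfolding left_reduced_def
proof (intro allI impI)
  fix i j assume ij: "i < n" "j < a"
  have jq: "j < q" using ij a by simp
  have Cij: "C $$ (i, j) = (if j = a - t + i \<and> i < t then 1 else 0)" if "i < n" "j < a" for i j
    using left that unfolding left_reduced_def by blast
  have "(embed_mat n t V * C * embed_mat q (a + d) Y) $$ (i, j) = C $$ (i, j)"
  proof (cases "t \<le> i \<and> i < t + b")
    case True
    have "(embed_mat n t V * C * embed_mat q (a + d) Y) $$ (i, j) = 0"
      by (rule embed_two_sided_zero[OF V Y C ij(1) jq]) (use True ij in \<open>auto simp: Cij split: if_splits\<close>)
    also have "0 = C $$ (i, j)" using True ij by (simp add: Cij)
    finally show ?thesis .
  next
    case False
    show ?thesis by (rule embed_two_sided_outside[OF V Y C ij(1) jq False]) (use ij in simp)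
  qed
  thus "(embed_mat n t V * C * embed_mat q (a + d) Y) $$ (i, j) = (if j = a - t + i \<and> i < t then 1 else 0)"
    using Cij[OF ij] by simp
qed

text \<open>\<open>X\<close> stays above row \<open>r\<close>, and \<open>U\<close> mixes only
  columns before \<open>m - s\<close>, where the bottom rows are zero.\<close>

lemma bottom_reduced_step:
  assumes bot: "bottom_reduced p m r s B" and B: "B \<in> carrier_mat p m"
    and X: "X \<in> carrier_mat k k" "d + k \<le> r" and r: "r \<le> p" and U: "U \<in> carrier_mat c c" "c \<le> m - s"
  shows "bottom_reduced p m r s (embed_mat p d X * B * embed_mat m 0 U)"
  unfolding bottom_reduced_def
proof (intro allI impI)
  fix i j assume ij: "i < p - r" "j < m"
  have ri: "r + i < p" using ij by simp
  have dp: "d + k \<le> p" and cm: "0 + c \<le> m" using X r U by auto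
  have "(embed_mat p d X * B * embed_mat m 0 U) $$ (r + i, j) = B $$ (r + i, j)"
  proof (cases "j < c")
    case True
    have "(embed_mat p d X * B * embed_mat m 0 U) $$ (r + i, j) = 0"
      by (rule embed_two_sided_zero[OF X(1) dp U(1) cm B ri ij(2)])
        (use True U(2) X(2) bottom_reducedD[OF bot] in \<open>auto split: if_splits\<close>)
    also have "0 = B $$ (r + i, j)"
    proof -
      have "j \<noteq> m - s + i" using True U(2) by linarith
      thus ?thesis using bot ij unfolding bottom_reduced_def by simp
    qed
    finally show ?thesis .
  next
    case False
    show ?thesis
      by (rule embed_two_sided_outside[OF X(1) dp U(1) cm B ri ij(2)]) (use False X(2) in auto)
  qed
  thus "(embed_mat p d X * B * embed_mat m 0 U) $$ (r + i, j) = (if j = m - s + i \<and> i < s then 1 else 0)"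
    using ij bot unfolding bottom_reduced_def by simp
qed

text \<open>Above row \<open>r\<close> nothing is required of B yet, so the inverse of
  \<open>Y\<close> may act on those rows and \<open>Y\<close> can be any invertible matrix.
  \<open>V\<close> is free because the left columns of C vanish from row \<open>t\<close>
  on.\<close>

lemma reduce_C_corner:
  assumes B: "B \<in> carrier_mat p m" and C: "C \<in> carrier_mat n q" and r: "r \<le> p" "a + r = q"
    and t: "t \<le> n" and bot: "bottom_reduced p m r s B" and left: "left_reduced n a t C"
  shows "\<exists>k B' C'. k \<le> n - t \<and> k \<le> r \<and>
    simul_equiv p q m n (unit_diagonal p q a r) B C (unit_diagonal p q a r) B' C' \<and>
    bottom_reduced p m r s B' \<and> left_reduced n a t C' \<and> corner_reduced n a r t k C'"
proof -
  obtain V Y Yi k where V: "V \<in> carrier_mat (n - t) (n - t)" "orthonormal_mat V" and Y: "inverse_pair r Y Yi"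
    and k: "k \<le> n - t" "k \<le> r" and eq: "V * window t a (n - t) r C * Y = right_unit_block (n - t) r k"
    by (rule column_compression[OF window_carrier[of t a "n - t" r C]]) (rule that)
  have Yc: "Y \<in> carrier_mat r r" "Yi \<in> carrier_mat r r" using Y unfolding inverse_pair_def by blast+
  have dV: "t + (n - t) \<le> n" and dY: "a + 0 + r \<le> q" and aq: "a + r \<le> q" "a \<le> q"
    and dr: "0 + r \<le> r" and c0: "0 \<le> m" "0 \<le> m - s" using r t by auto
  define B' where "B' = embed_mat p 0 Yi * B * embed_mat m 0 (1\<^sub>m 0)"
  define C' where "C' = embed_mat n t V * C * embed_mat q (a + 0) Y"
  have "simul_equiv p q m n (unit_diagonal p q a r) B C (unit_diagonal p q a r) B' C'"
    unfolding B'_def C'_def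
    by (rule simul_equiv_block_step[OF inverse_pair_sym[OF Y] dr r(1) aq(1) one_mat_0_orthonormal c0(1) V dV])
  moreover have "bottom_reduced p m r s B'"
    unfolding B'_def by (rule bottom_reduced_step[OF bot B Yc(2) dr r(1) one_mat_0_orthonormal(1) c0(2)])
  moreover have "left_reduced n a t C'"
    unfolding C'_def by (rule left_reduced_step[OF left C V(1) dV Yc(1) dY aq(2)])
  moreover have "corner_reduced n a r t k C'"
    unfolding corner_reduced_def
  proof (intro allI impI)
    fix i j assume ij: "i < n - t" "j < r"
    have "C' $$ (t + i, a + j) = right_unit_block (n - t) r k $$ (i, j)"
      using embed_two_sided_inside[OF V(1) dV Yc(1) dY C ij] unfolding C'_def by (simp add: eq)
    thus "C' $$ (t + i, a + j) = (if j = r - k + i \<and> i < k then 1 else 0)" using ij by simp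
  qed
  ultimately show ?thesis using k by blast
qed

text \<open>Here \<open>V\<close> acts on the rows of B, its transpose on the facing columns of C,
  and \<open>V\<close> once more on the rows of C, so that the unit block becomes V I V^T = I.
  \<open>U\<close> is confined to the columns in which the bottom rows of B vanish.\<close>

lemma reduce_B_middle:
  assumes B: "B \<in> carrier_mat p m" and C: "C \<in> carrier_mat n q" and r: "r \<le> p" "a + r = q"
    and t: "t \<le> n" and k: "k \<le> n - t" "k \<le> r" and bot: "bottom_reduced p m r s B"
    and left: "left_reduced n a t C" and cor: "corner_reduced n a r t k C"
  shows "\<exists>l \<sigma> B' C'. l \<le> k \<and> l \<le> m - s \<and> (\<forall>i<l. 0 < \<sigma> i) \<and>
    simul_equiv p q m n (unit_diagonal p q a r) B C (unit_diagonal p q a r) B' C' \<and>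
    bottom_reduced p m r s B' \<and> left_reduced n a t C' \<and> corner_reduced n a r t k C' \<and>
    middle_reduced r k (m - s) l \<sigma> B'"
proof -
  obtain V U l \<sigma> where V: "V \<in> carrier_mat k k" "orthonormal_mat V"
    and U: "U \<in> carrier_mat (m - s) (m - s)" "orthonormal_mat U"
    and l: "l \<le> k" "l \<le> m - s" and \<sigma>: "\<And>i. i < l \<Longrightarrow> 0 < \<sigma> i"
    and eq: "V * window (r - k) 0 k (m - s) B * U =
      mat k (m - s) (\<lambda>(i, j). if j = m - s - l + i \<and> i < l then \<sigma> i else 0)"
    by (rule svd_right_aligned[OF window_carrier[of "r - k" 0 k "m - s" B]]) (rule that)
  have VT: "transpose_mat V \<in> carrier_mat k k" using V(1) by simp
  have dV: "t + k \<le> n" and dY: "a + (r - k) + k \<le> q" and aq: "a + r \<le> q" "a \<le> q"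
    and dr: "r - k + k \<le> r" and dp: "r - k + k \<le> p" and c: "m - s \<le> m" "m - s \<le> m - s" "0 + (m - s) \<le> m"
    using r t k by auto
  define B' where "B' = embed_mat p (r - k) V * B * embed_mat m 0 U"
  define C' where "C' = embed_mat n t V * C * embed_mat q (a + (r - k)) (transpose_mat V)"
  have "simul_equiv p q m n (unit_diagonal p q a r) B C (unit_diagonal p q a r) B' C'"
    unfolding B'_def C'_def
    by (rule simul_equiv_block_step[OF inverse_pair_orthonormal[OF V] dr r(1) aq(1) U c(1) V dV])
  moreover have "bottom_reduced p m r s B'"
    unfolding B'_def by (rule bottom_reduced_step[OF bot B V(1) dr r(1) U(1) c(2)])
  moreover have "left_reduced n a t C'"
    unfolding C'_def by (rule left_reduced_step[OF left C V(1) dV VT dY aq(2)])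
  moreover have "corner_reduced n a r t k C'"
    unfolding corner_reduced_def
  proof (intro allI impI)
    fix i j assume ij: "i < n - t" "j < r"
    have ti: "t + i < n" and aj: "a + j < q" using ij r by auto
    show "C' $$ (t + i, a + j) = (if j = r - k + i \<and> i < k then 1 else 0)"
    proof (cases "i < k \<and> r - k \<le> j")
      case True
      have jk: "i < k" "j - (r - k) < k" using True ij by auto
      have "window t (a + (r - k)) k k C = 1\<^sub>m k"
        by (rule eq_matI) (use corner_reducedD[OF cor] k r in \<open>auto simp: add.assoc\<close>)
      hence "(V * window t (a + (r - k)) k k C * transpose_mat V) = 1\<^sub>m k"
        using right_mult_one_mat[OF V(1)] orthonormal_mat_mult_transpose[OF V] by simp
      hence "C' $$ (t + i, a + (r - k) + (j - (r - k))) = 1\<^sub>m k $$ (i, j - (r - k))"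
        using embed_two_sided_inside[OF V(1) dV VT dY C jk] unfolding C'_def by simp
      thus ?thesis using True jk by auto
    next
      \<comment> \<open>Away from the unit block only zeros of the corner window are
        combined.\<close>
      case False
      have "C' $$ (t + i, a + j) = 0"
        unfolding C'_def
      proof (rule embed_two_sided_zero[OF V(1) dV VT dY C ti aj])
        fix i' j' assume ij': "i' < n" "j' < q"
          and i': "if t \<le> t + i \<and> t + i < t + k then t \<le> i' \<and> i' < t + k else i' = t + i"
          and j': "if a + (r - k) \<le> a + j \<and> a + j < a + (r - k) + k
            then a + (r - k) \<le> j' \<and> j' < a + (r - k) + k else j' = a + j"
        have "t \<le> i'" "a \<le> j'" using i' j' by (auto split: if_splits)
        moreover have "\<not> (j' - a = r - k + (i' - t) \<and> i' - t < k)"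
          using False i' j' ij by (auto split: if_splits)
        ultimately show "C $$ (i', j') = 0"
          using corner_reducedD[OF cor, of i' j'] ij' r by simp
      qed
      thus ?thesis using False by auto
    qed
  qed
  moreover have "middle_reduced r k (m - s) l \<sigma> B'"
    unfolding middle_reduced_def
  proof (intro allI impI)
    fix i j assume ij: "i < k" "j < m - s"
    show "B' $$ (r - k + i, j) = (if j = m - s - l + i \<and> i < l then \<sigma> i else 0)"
      using embed_two_sided_inside[OF V(1) dp U(1) c(3) B ij] ij unfolding B'_def eq by simp
  qed
  ultimately show ?thesis using l \<sigma> by blast
qed

text \<open>The rows of B before \<open>r - k\<close> face columns of C that vanish from row
  \<open>t\<close> on, so \<open>X\<close> may again be any invertible matrix: in the corner of C
  its inverse meets only zeros. The columns of B before \<open>m - s - l\<close> vanish from row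
  \<open>r - k\<close> on, which frees \<open>U\<close>. Entries of C in rows before
  \<open>t\<close> and columns from \<open>a\<close> on do change, but belong to no reduced
  window.\<close>

lemma reduce_B_top:
  assumes B: "B \<in> carrier_mat p m" and C: "C \<in> carrier_mat n q" and r: "r \<le> p" "a + r = q"
    and t: "t \<le> n" and k: "k \<le> n - t" "k \<le> r" and l: "l \<le> k" "l \<le> m - s"
    and bot: "bottom_reduced p m r s B"
    and left: "left_reduced n a t C" and cor: "corner_reduced n a r t k C"
    and mid: "middle_reduced r k (m - s) l \<sigma> B"
  shows "\<exists>h B' C'. h \<le> r - k \<and> h \<le> m - s - l \<and>
    simul_equiv p q m n (unit_diagonal p q a r) B C (unit_diagonal p q a r) B' C' \<and>
    bottom_reduced p m r s B' \<and> left_reduced n a t C' \<and> corner_reduced n a r t k C' \<and>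
    middle_reduced r k (m - s) l \<sigma> B' \<and> top_reduced (r - k) (m - s - l) h B'"
proof -
  let ?c = "m - s - l"
  obtain X Xi U h where X: "inverse_pair (r - k) X Xi" and U: "U \<in> carrier_mat ?c ?c" "orthonormal_mat U"
    and h: "h \<le> r - k" "h \<le> ?c" and eq: "X * window 0 0 (r - k) ?c B * U = right_unit_block (r - k) ?c h"
    by (rule row_compression[OF window_carrier[of 0 0 "r - k" ?c B]]) (rule that)
  have Xc: "X \<in> carrier_mat (r - k) (r - k)" "Xi \<in> carrier_mat (r - k) (r - k)"
    using X unfolding inverse_pair_def by blast+
  have dV: "t + 0 \<le> n" and dY: "a + 0 + (r - k) \<le> q" and aq: "a + r \<le> q" "a \<le> q"
    and dr: "0 + (r - k) \<le> r" and dp: "0 + (r - k) \<le> p" and c: "?c \<le> m" "?c \<le> m - s" "0 + ?c \<le> m"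
    using r t k by auto
  define B' where "B' = embed_mat p 0 X * B * embed_mat m 0 U"
  define C' where "C' = embed_mat n t (1\<^sub>m 0) * C * embed_mat q (a + 0) Xi"
  have "simul_equiv p q m n (unit_diagonal p q a r) B C (unit_diagonal p q a r) B' C'"
    unfolding B'_def C'_def
    by (rule simul_equiv_block_step[OF X dr r(1) aq(1) U c(1) one_mat_0_orthonormal dV])
  moreover have "bottom_reduced p m r s B'"
    unfolding B'_def by (rule bottom_reduced_step[OF bot B Xc(1) dr r(1) U(1) c(2)])
  moreover have "left_reduced n a t C'"
    unfolding C'_def by (rule left_reduced_step[OF left C one_mat_0_orthonormal(1) dV Xc(2) dY aq(2)])
  moreover have "corner_reduced n a r t k C'"
    unfolding corner_reduced_def
  proof (intro allI impI)
    fix i j assume ij: "i < n - t" "j < r"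
    have ti: "t + i < n" and aj: "a + j < q" using ij r by auto
    have Cij: "C $$ (t + i, a + j) = (if j = r - k + i \<and> i < k then 1 else 0)" if "j < r" for j
      using cor ij(1) that unfolding corner_reduced_def by blast
    have "C' $$ (t + i, a + j) = C $$ (t + i, a + j)"
    proof (cases "j < r - k")
      case True
      have "C' $$ (t + i, a + j) = 0"
        unfolding C'_def
      proof (rule embed_two_sided_zero[OF one_mat_0_orthonormal(1) dV Xc(2) dY C ti aj])
        fix i' j' assume i': "if t \<le> t + i \<and> t + i < t + 0 then t \<le> i' \<and> i' < t + 0 else i' = t + i"
          and j': "if a + 0 \<le> a + j \<and> a + j < a + 0 + (r - k) then a + 0 \<le> j' \<and> j' < a + 0 + (r - k) else j' = a + j"
        have "a + 0 \<le> a + j \<and> a + j < a + 0 + (r - k)" using True by linarith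
        from j'[unfolded if_P[OF this]] have "a \<le> j'" "j' - a < r - k" "j' - a < r" by linarith+
        moreover have "i' = t + i" using i' by simp
        moreover have "j' - a \<noteq> r - k + i" using \<open>j' - a < r - k\<close> by linarith
        ultimately show "C $$ (i', j') = 0" using Cij[of "j' - a"] by simp
      qed
      also have "0 = C $$ (t + i, a + j)"
      proof -
        have "j \<noteq> r - k + i" using True by linarith
        thus ?thesis using Cij[OF ij(2)] by simp
      qed
      finally show ?thesis .
    next
      case False
      show ?thesis unfolding C'_def
        by (rule embed_two_sided_outside[OF one_mat_0_orthonormal(1) dV Xc(2) dY C ti aj])
          (use False in auto)
    qed
    thus "C' $$ (t + i, a + j) = (if j = r - k + i \<and> i < k then 1 else 0)" using Cij[OF ij(2)] by simp
  qed
  moreover have "middle_reduced r k (m - s) l \<sigma> B'"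
    unfolding middle_reduced_def
  proof (intro allI impI)
    fix i j assume ij: "i < k" "j < m - s"
    have ri: "r - k + i < p" and jm: "j < m" using ij r k by auto
    have Bij: "B $$ (r - k + i, j) = (if j = m - s - l + i \<and> i < l then \<sigma> i else 0)" if "j < m - s" for j
      using mid ij(1) that unfolding middle_reduced_def by blast
    have "B' $$ (r - k + i, j) = B $$ (r - k + i, j)"
    proof (cases "j < ?c")
      case True
      have "B' $$ (r - k + i, j) = 0"
        unfolding B'_def
      proof (rule embed_two_sided_zero[OF Xc(1) dp U(1) c(3) B ri jm])
        fix i' j' assume "if 0 \<le> r - k + i \<and> r - k + i < 0 + (r - k) then 0 \<le> i' \<and> i' < 0 + (r - k) else i' = r - k + i"
          and "if 0 \<le> j \<and> j < 0 + ?c then 0 \<le> j' \<and> j' < 0 + ?c else j' = j"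
        hence "i' = r - k + i" "j' < ?c" using True by auto
        moreover have "j' < m - s" "j' \<noteq> m - s - l + i" using \<open>j' < ?c\<close> by linarith+
        ultimately show "B $$ (i', j') = 0" using Bij[of j'] by simp
      qed
      also have "0 = B $$ (r - k + i, j)"
      proof -
        have "j \<noteq> m - s - l + i" using True by linarith
        thus ?thesis using Bij[OF ij(2)] by simp
      qed
      finally show ?thesis .
    next
      case False
      show ?thesis unfolding B'_def
        by (rule embed_two_sided_outside[OF Xc(1) dp U(1) c(3) B ri jm]) (use False in auto)
    qed
    thus "B' $$ (r - k + i, j) = (if j = m - s - l + i \<and> i < l then \<sigma> i else 0)" using Bij[OF ij(2)] by simp
  qed
  moreover have "top_reduced (r - k) ?c h B'"
    unfolding top_reduced_def
  proof (intro allI impI)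
    fix i j assume ij: "i < r - k" "j < ?c"
    show "B' $$ (i, j) = (if j = ?c - h + i \<and> i < h then 1 else 0)"
      using embed_two_sided_inside[OF Xc(1) dp U(1) c(3) B ij] ij unfolding B'_def eq by simp
  qed
  ultimately show ?thesis using h by blast
qed

text \<open>\<open>r\<close>, \<open>s\<close>, \<open>t\<close>, \<open>k\<close>,
  \<open>l\<close>, \<open>h\<close> are the ranks of the windows treated one after the other, each
  taken in the matrices left by the preceding step.\<close>

theorem restricted_svd:
  assumes A: "A \<in> carrier_mat p q" and B: "B \<in> carrier_mat p m" and C: "C \<in> carrier_mat n q"
  shows "\<exists>a r s t k l h \<sigma> B' C'. r \<le> p \<and> a + r = q \<and> s \<le> p - r \<and> s \<le> m \<and> t \<le> n \<and> t \<le> a \<and>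
    k \<le> n - t \<and> k \<le> r \<and> l \<le> k \<and> l \<le> m - s \<and> h \<le> r - k \<and> h \<le> m - s - l \<and> (\<forall>i<l. 0 < \<sigma> i) \<and>
    simul_equiv p q m n A B C (unit_diagonal p q a r) B' C' \<and>
    bottom_reduced p m r s B' \<and> left_reduced n a t C' \<and> corner_reduced n a r t k C' \<and>
    middle_reduced r k (m - s) l \<sigma> B' \<and> top_reduced (r - k) (m - s - l) h B'"
proof -
  obtain r B1 C1 where r: "r \<le> p" "r \<le> q"
    and e1: "simul_equiv p q m n A B C (unit_diagonal p q (q - r) r) B1 C1"
    using reduce_A[OF A] by blast
  define a where "a = q - r"
  have ar: "a + r = q" using r unfolding a_def by simp
  let ?E = "unit_diagonal p q a r"
  note e1 = e1[folded a_def]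
  note E = unit_diagonal_carrier[of p q a r]
  note tr = simul_equiv_trans[OF A B C]
  obtain s t B2 C2 where s: "s \<le> p - r" "s \<le> m" and t: "t \<le> n" "t \<le> a"
    and e2: "simul_equiv p q m n ?E B1 C1 ?E B2 C2"
    and 2: "bottom_reduced p m r s B2" "left_reduced n a t C2"
    using reduce_B_bottom_C_left[OF simul_equiv_carrier(2,3)[OF e1] r(1) ar] by blast
  obtain k B3 C3 where k: "k \<le> n - t" "k \<le> r" and e3: "simul_equiv p q m n ?E B2 C2 ?E B3 C3"
    and 3: "bottom_reduced p m r s B3" "left_reduced n a t C3" "corner_reduced n a r t k C3"
    using reduce_C_corner[OF simul_equiv_carrier(2,3)[OF e2] r(1) ar t(1) 2] by blast
  obtain l \<sigma> B4 C4 where l: "l \<le> k" "l \<le> m - s" and \<sigma>: "\<forall>i<l. 0 < \<sigma> i"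
    and e4: "simul_equiv p q m n ?E B3 C3 ?E B4 C4"
    and 4: "bottom_reduced p m r s B4" "left_reduced n a t C4" "corner_reduced n a r t k C4"
      "middle_reduced r k (m - s) l \<sigma> B4"
    using reduce_B_middle[OF simul_equiv_carrier(2,3)[OF e3] r(1) ar t(1) k 3] by blast
  obtain h B5 C5 where h: "h \<le> r - k" "h \<le> m - s - l"
    and e5: "simul_equiv p q m n ?E B4 C4 ?E B5 C5"
    and 5: "bottom_reduced p m r s B5" "left_reduced n a t C5" "corner_reduced n a r t k C5"
      "middle_reduced r k (m - s) l \<sigma> B5" "top_reduced (r - k) (m - s - l) h B5"
    using reduce_B_top[OF simul_equiv_carrier(2,3)[OF e4] r(1) ar t(1) k l 4] by blast
  have "simul_equiv p q m n A B C ?E B5 C5"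
    by (rule tr[OF tr[OF tr[OF tr[OF e1 e2] e3] e4] e5])
  show ?thesis
    by (rule exI[of _ a], rule exI[of _ r], rule exI[of _ s], rule exI[of _ t], rule exI[of _ k],
        rule exI[of _ l], rule exI[of _ h], rule exI[of _ \<sigma>], rule exI[of _ B5], rule exI[of _ C5],
        intro conjI) fact+
qed

section \<open>Block triangular form\<close>

text \<open>Triangularity of \<open>R\<close> kills the contribution of the rows of \<open>K\<close>
  above \<open>i\<close>, so column \<open>j\<close> must be known only from row \<open>i\<close>
  downwards. \<open>mult_upper_single\<close> is the mirror image for columns.\<close>

lemma upper_mult_single:
  assumes R: "R \<in> carrier_mat p p" "upper_triangular R" and K: "K \<in> carrier_mat p c"
    and ij: "i < p" "j < c" and k0: "k0 < p"
    and zero: "\<And>k. i \<le> k \<Longrightarrow> k < p \<Longrightarrow> k \<noteq> k0 \<Longrightarrow> K $$ (k, j) = (0::real)"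
  shows "(R * K) $$ (i, j) = R $$ (i, k0) * K $$ (k0, j)"
proof -
  have "(R * K) $$ (i, j) = (\<Sum>k<p. R $$ (i, k) * K $$ (k, j))"
    by (rule index_mult_mat_sum[OF R(1) K ij])
  also have "\<dots> = (\<Sum>k<p. if k = k0 then R $$ (i, k0) * K $$ (k0, j) else 0)"
  proof (rule sum.cong)
    fix k assume "k \<in> {..<p}"
    hence k: "k < p" by simp
    have "R $$ (i, k) = 0" if "k < i" by (rule upper_triangularD[OF R(2) that]) (use R(1) ij in simp)
    thus "R $$ (i, k) * K $$ (k, j) = (if k = k0 then R $$ (i, k0) * K $$ (k0, j) else 0)"
      using zero[OF _ k] by (cases "k < i") auto
  qed simp
  also have "\<dots> = R $$ (i, k0) * K $$ (k0, j)" using k0 by (subst sum.delta) auto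
  finally show ?thesis .
qed

lemma upper_mult_zero:
  assumes R: "R \<in> carrier_mat p p" "upper_triangular R" and K: "K \<in> carrier_mat p c"
    and ij: "i < p" "j < c" and zero: "\<And>k. i \<le> k \<Longrightarrow> k < p \<Longrightarrow> K $$ (k, j) = (0::real)"
  shows "(R * K) $$ (i, j) = 0"
  using upper_mult_single[OF R K ij ij(1)] zero ij(1) by simp

lemma mult_upper_single:
  assumes K: "K \<in> carrier_mat n q" and S: "S \<in> carrier_mat q q" "upper_triangular S"
    and ij: "i < n" "j < q" and k0: "k0 < q"
    and zero: "\<And>k. k \<le> j \<Longrightarrow> k \<noteq> k0 \<Longrightarrow> K $$ (i, k) = (0::real)"
  shows "(K * S) $$ (i, j) = K $$ (i, k0) * S $$ (k0, j)"
proof -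
  have "(K * S) $$ (i, j) = (\<Sum>k<q. K $$ (i, k) * S $$ (k, j))"
    by (rule index_mult_mat_sum[OF K S(1) ij])
  also have "\<dots> = (\<Sum>k<q. if k = k0 then K $$ (i, k0) * S $$ (k0, j) else 0)"
  proof (rule sum.cong)
    fix k assume "k \<in> {..<q}"
    hence k: "k < q" by simp
    have "S $$ (k, j) = 0" if "j < k" by (rule upper_triangularD[OF S(2) that]) (use S(1) k in simp)
    thus "K $$ (i, k) * S $$ (k, j) = (if k = k0 then K $$ (i, k0) * S $$ (k0, j) else 0)"
      using zero[of k] by (cases "j < k") auto
  qed simp
  also have "\<dots> = K $$ (i, k0) * S $$ (k0, j)" using k0 by (subst sum.delta) auto
  finally show ?thesis .
qed

lemma mult_upper_zero:
  assumes K: "K \<in> carrier_mat n q" and S: "S \<in> carrier_mat q q" "upper_triangular S"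
    and ij: "i < n" "j < q" and zero: "\<And>k. k \<le> j \<Longrightarrow> K $$ (i, k) = (0::real)"
  shows "(K * S) $$ (i, j) = 0"
  using mult_upper_single[OF K S ij ij(2)] zero by simp

lemma window_eq_zero:
  "(\<And>i j. i < r \<Longrightarrow> j < c \<Longrightarrow> T $$ (d + i, e + j) = 0) \<Longrightarrow> window d e r c T = 0\<^sub>m r c"
  by (rule eq_matI) simp_all

lemma upper_mult_unit_diagonal:
  assumes R: "R \<in> carrier_mat p p" "upper_triangular R" and r: "r \<le> p" "a + r = q" and ij: "i < p" "j < q"
  shows "(R * unit_diagonal p q a r) $$ (i, j) = (if a \<le> j then R $$ (i, j - a) else 0)"
proof (cases "a \<le> j")
  case True
  have j: "j - a < r" "j - a < p" using True r ij by linarith+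
  have "(R * unit_diagonal p q a r) $$ (i, j) = R $$ (i, j - a) * unit_diagonal p q a r $$ (j - a, j)"
    by (rule upper_mult_single[OF R unit_diagonal_carrier ij j(2)]) (use ij True in \<open>auto simp: index_unit_diagonal\<close>)
  thus ?thesis using True j ij by (simp add: index_unit_diagonal)
next
  case False
  have "(R * unit_diagonal p q a r) $$ (i, j) = 0"
    by (rule upper_mult_zero[OF R unit_diagonal_carrier ij]) (use ij False in \<open>simp add: index_unit_diagonal\<close>)
  thus ?thesis using False by simp
qed

lemma triangular_A_zero:
  assumes R: "R \<in> carrier_mat p p" "upper_triangular R" and S: "S \<in> carrier_mat q q" "upper_triangular S"
    and r: "r \<le> p" "a + r = q" and ij: "i < p" "j < q" "j < a + i"
  shows "(R * unit_diagonal p q a r * S) $$ (i, j) = 0"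
proof (rule mult_upper_zero[OF mult_carrier_mat[OF R(1) unit_diagonal_carrier] S ij(1,2)])
  fix k assume k: "k \<le> j"
  hence kq: "k < q" using ij by simp
  show "(R * unit_diagonal p q a r) $$ (i, k) = 0"
  proof (cases "a \<le> k")
    case True
    have "R $$ (i, k - a) = 0" by (rule upper_triangularD[OF R(2)]) (use True k ij R(1) in auto)
    thus ?thesis unfolding upper_mult_unit_diagonal[OF R r ij(1) kq] by simp
  next
    case False
    thus ?thesis unfolding upper_mult_unit_diagonal[OF R r ij(1) kq] by simp
  qed
qed

text \<open>Diagonal blocks of triangular matrices multiply blockwise: summation indices before the
  block are killed by \<open>R\<close>, those behind it by \<open>S\<close>. The units in between
  only shift the column index by \<open>a\<close>.\<close>

lemma triangular_A_window:
  assumes R: "R \<in> carrier_mat p p" "upper_triangular R" and S: "S \<in> carrier_mat q q" "upper_triangular S"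
    and r: "r \<le> p" "a + r = q" and d: "d + l \<le> r"
  shows "window d (a + d) l l (R * unit_diagonal p q a r * S) = window d d l l R * window (a + d) (a + d) l l S"
proof (rule eq_matI)
  fix i j
  assume "i < dim_row (window d d l l R * window (a + d) (a + d) l l S)"
    and "j < dim_col (window d d l l R * window (a + d) (a + d) l l S)"
  hence ij: "i < l" "j < l" by simp_all
  have di: "d + i < p" and aj: "a + d + j < q" using ij d r by linarith+
  let ?g = "\<lambda>k. (R * unit_diagonal p q a r) $$ (d + i, k) * S $$ (k, a + d + j)"
  have "(R * unit_diagonal p q a r * S) $$ (d + i, a + d + j) = (\<Sum>k<q. ?g k)"
    by (rule index_mult_mat_sum[OF mult_carrier_mat[OF R(1) unit_diagonal_carrier] S(1) di aj])
  also have "\<dots> = (\<Sum>k=a + d..<a + d + l. ?g k)"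
  proof (rule sum.mono_neutral_right)
    show "{a + d..<a + d + l} \<subseteq> {..<q}" using d r by auto
    show "\<forall>k\<in>{..<q} - {a + d..<a + d + l}. ?g k = 0"
    proof
      fix k assume "k \<in> {..<q} - {a + d..<a + d + l}"
      hence k: "k < q" "k < a + d \<or> a + d + l \<le> k" by auto
      show "?g k = 0"
      proof (cases "k < a + d")
        case True
        have "(R * unit_diagonal p q a r) $$ (d + i, k) = 0"
        proof (cases "a \<le> k")
          case ak: True
          have "R $$ (d + i, k - a) = 0" by (rule upper_triangularD[OF R(2)]) (use True ak di R(1) in auto)
          thus ?thesis unfolding upper_mult_unit_diagonal[OF R r di k(1)] by simp
        next
          case False
          thus ?thesis unfolding upper_mult_unit_diagonal[OF R r di k(1)] by simp
        qed
        thus ?thesis by simp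
      next
        case False
        have "S $$ (k, a + d + j) = 0" by (rule upper_triangularD[OF S(2)]) (use False k ij S(1) in auto)
        thus ?thesis by simp
      qed
    qed
  qed simp
  also have "\<dots> = (\<Sum>k<l. ?g (k + (a + d)))"
    using sum.shift_bounds_nat_ivl[of ?g 0 "a + d" l] by (simp add: atLeast0LessThan add.commute)
  also have "\<dots> = (\<Sum>k<l. window d d l l R $$ (i, k) * window (a + d) (a + d) l l S $$ (k, j))"
  proof (rule sum.cong)
    fix k assume "k \<in> {..<l}"
    hence k: "k < l" by simp
    have kq: "k + (a + d) < q" and ak: "a \<le> k + (a + d)" using k d r by linarith+
    have kk: "k + (a + d) - a = d + k" "k + (a + d) = a + d + k" by simp_all
    show "?g (k + (a + d)) = window d d l l R $$ (i, k) * window (a + d) (a + d) l l S $$ (k, j)"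
      unfolding upper_mult_unit_diagonal[OF R r di kq] if_P[OF ak] kk(1) index_window[OF ij(1) k] index_window[OF k ij(2)]
      unfolding kk(2) ..
  qed simp
  also have "\<dots> = (window d d l l R * window (a + d) (a + d) l l S) $$ (i, j)"
    by (rule index_mult_mat_sum[OF window_carrier window_carrier ij, symmetric])
  finally show "window d (a + d) l l (R * unit_diagonal p q a r * S) $$ (i, j)
      = (window d d l l R * window (a + d) (a + d) l l S) $$ (i, j)"
    unfolding index_window[OF ij] .
qed simp_all

lemma upper_triangular_window:
  assumes "R \<in> carrier_mat p p" "upper_triangular R" "d + l \<le> p"
  shows "upper_triangular (window d d l l R)"
proof (rule upper_triangularI)
  fix i j assume "j < i" "i < dim_row (window d d l l R)"
  hence ij: "j < i" "i < l" "j < l" by simp_all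
  have "R $$ (d + i, d + j) = 0" by (rule upper_triangularD[OF assms(2)]) (use ij assms in simp_all)
  thus "window d d l l R $$ (i, j) = 0" unfolding index_window[OF ij(2,3)] .
qed

lemma window_triangular_inverse_pair:
  assumes R: "inverse_pair p R Ri" "upper_triangular R" and d: "d + l \<le> p"
  obtains N where "inverse_pair l (window d d l l R) N"
proof (rule triangular_inverse_pair[OF window_carrier upper_triangular_window[OF _ R(2) d]])
  show "R \<in> carrier_mat p p" using R(1) unfolding inverse_pair_def by blast
  show "window d d l l R $$ (i, i) \<noteq> 0" if i: "i < l" for i
    unfolding index_window[OF i i] by (rule inverse_pair_triangular_diag[OF R]) (use i d in simp)
qed (rule that)

text \<open>The staircase runs along the diagonals of the three blocks that have to be square, which
  is why the last three widths repeat \<open>p1\<close>, \<open>p2\<close>,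
  \<open>p3\<close>.\<close>

lemma block_form_A:
  assumes T: "T \<in> carrier_mat (p1 + p2 + p3 + p4 + p5) (q1 + q2 + p1 + p2 + p3)"
    and zero: "\<And>i j. i < p1 + p2 + p3 + p4 + p5 \<Longrightarrow> j < q1 + q2 + p1 + p2 + p3 \<Longrightarrow> j < q1 + q2 + i \<Longrightarrow> T $$ (i, j) = 0"
  shows "T = block_mat [p1, p2, p3, p4, p5] (q1 + q2 + p1 + p2 + p3)
    [[0\<^sub>m p1 q1, 0\<^sub>m p1 q2, window 0 (q1 + q2) p1 p1 T, window 0 (q1 + q2 + p1) p1 p2 T, window 0 (q1 + q2 + p1 + p2) p1 p3 T],
     [0\<^sub>m p2 q1, 0\<^sub>m p2 q2, 0\<^sub>m p2 p1, window p1 (q1 + q2 + p1) p2 p2 T, window p1 (q1 + q2 + p1 + p2) p2 p3 T],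
     [0\<^sub>m p3 q1, 0\<^sub>m p3 q2, 0\<^sub>m p3 p1, 0\<^sub>m p3 p2, window (p1 + p2) (q1 + q2 + p1 + p2) p3 p3 T],
     [0\<^sub>m p4 q1, 0\<^sub>m p4 q2, 0\<^sub>m p4 p1, 0\<^sub>m p4 p2, 0\<^sub>m p4 p3],
     [0\<^sub>m p5 q1, 0\<^sub>m p5 q2, 0\<^sub>m p5 p1, 0\<^sub>m p5 p2, 0\<^sub>m p5 p3]]" (is "T = block_mat ?rs ?n ?W")
proof -
  \<comment> \<open>A window vanishes as soon as its top right entry, at row \<open>d\<close> and
    column \<open>e + c - 1\<close>, lies below the staircase.\<close>
  have z: "window d e r c T = 0\<^sub>m r c"
    if "d + r \<le> p1 + p2 + p3 + p4 + p5" "e + c \<le> q1 + q2 + p1 + p2 + p3" "e + c \<le> q1 + q2 + d" for d e r c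
    by (rule window_eq_zero, rule zero) (use that in linarith)+
  have "window_rows 0 ?rs [q1, q2, p1, p2, p3] T = ?W" by (simp add: z)
  moreover have "sum_list [q1, q2, p1, p2, p3] = ?n" by simp
  moreover have "T = block_mat ?rs (sum_list [q1, q2, p1, p2, p3]) (window_rows 0 ?rs [q1, q2, p1, p2, p3] T)"
    by (rule block_mat_windows_all) (use T in \<open>simp add: add.assoc\<close>)
  ultimately show ?thesis by (simp only:)
qed

text \<open>The staircase changes its offset between column blocks: the three disjuncts follow the
  diagonal of B12 from its top left corner, the diagonal of B23 and that of B44. Since
  \<open>m2 \<le> p1\<close>, the first of them clears the second block column below the first
  \<open>p1\<close> rows.\<close>

lemma block_form_B:
  assumes T: "T \<in> carrier_mat (p1 + p2 + p3 + p4 + p5) (m1 + m2 + p2 + p4)" and m2: "m2 \<le> p1"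
    and zero: "\<And>i j. i < p1 + p2 + p3 + p4 + p5 \<Longrightarrow> j < m1 + m2 + p2 + p4 \<Longrightarrow>
      j < m1 + m2 \<and> j < m1 + i \<or> j < m1 + m2 + p2 \<and> j + p1 < m1 + m2 + i \<or>
      j + (p1 + p2 + p3) < m1 + m2 + p2 + i \<Longrightarrow> T $$ (i, j) = 0"
  shows "T = block_mat [p1, p2, p3, p4, p5] (m1 + m2 + p2 + p4)
    [[0\<^sub>m p1 m1, window 0 m1 p1 m2 T, window 0 (m1 + m2) p1 p2 T, window 0 (m1 + m2 + p2) p1 p4 T],
     [0\<^sub>m p2 m1, 0\<^sub>m p2 m2, window p1 (m1 + m2) p2 p2 T, window p1 (m1 + m2 + p2) p2 p4 T],
     [0\<^sub>m p3 m1, 0\<^sub>m p3 m2, 0\<^sub>m p3 p2, window (p1 + p2) (m1 + m2 + p2) p3 p4 T],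
     [0\<^sub>m p4 m1, 0\<^sub>m p4 m2, 0\<^sub>m p4 p2, window (p1 + p2 + p3) (m1 + m2 + p2) p4 p4 T],
     [0\<^sub>m p5 m1, 0\<^sub>m p5 m2, 0\<^sub>m p5 p2, 0\<^sub>m p5 p4]]" (is "T = block_mat ?rs ?n ?W")
proof -
  let ?p = "p1 + p2 + p3 + p4 + p5"
  have z1: "window d e r c T = 0\<^sub>m r c" if "d + r \<le> ?p" "e + c \<le> ?n" "e + c \<le> m1 + m2 \<and> e + c \<le> m1 + d" for d e r c
    by (rule window_eq_zero, rule zero) (use that in linarith)+
  have z2: "window d e r c T = 0\<^sub>m r c" if "d + r \<le> ?p" "e + c \<le> ?n"
    "e + c \<le> m1 + m2 + p2 \<and> e + c + p1 \<le> m1 + m2 + d" for d e r c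
    by (rule window_eq_zero, rule zero) (use that in linarith)+
  have z3: "window d e r c T = 0\<^sub>m r c" if "d + r \<le> ?p" "e + c \<le> ?n"
    "e + c + (p1 + p2 + p3) \<le> m1 + m2 + p2 + d" for d e r c
    by (rule window_eq_zero, rule zero) (use that in linarith)+
  have "window_rows 0 ?rs [m1, m2, p2, p4] T = ?W" using m2 by (simp add: z1 z2 z3)
  moreover have "sum_list [m1, m2, p2, p4] = ?n" by simp
  moreover have "T = block_mat ?rs (sum_list [m1, m2, p2, p4]) (window_rows 0 ?rs [m1, m2, p2, p4] T)"
    by (rule block_mat_windows_all) (use T in \<open>simp add: add.assoc\<close>)
  ultimately show ?thesis by (simp only:)
qed

text \<open>The first disjunct follows the diagonal of C12, the second the common diagonal of C24
  and C35. The guard \<open>n1 \<le> i\<close> keeps the second out of the first block row, where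
  nothing to the right of C12 is controlled.\<close>

lemma block_form_C:
  assumes T: "T \<in> carrier_mat (n1 + n2 + n3 + n4) (q1 + n1 + q3 + n2 + n3)"
    and zero: "\<And>i j. i < n1 + n2 + n3 + n4 \<Longrightarrow> j < q1 + n1 + q3 + n2 + n3 \<Longrightarrow>
      j < q1 + i \<and> j < q1 + n1 \<or> n1 \<le> i \<and> j + n1 < q1 + n1 + q3 + i \<Longrightarrow> T $$ (i, j) = 0"
  shows "T = block_mat [n1, n2, n3, n4] (q1 + n1 + q3 + n2 + n3)
    [[0\<^sub>m n1 q1, window 0 q1 n1 n1 T, window 0 (q1 + n1) n1 q3 T, window 0 (q1 + n1 + q3) n1 n2 T,
        window 0 (q1 + n1 + q3 + n2) n1 n3 T],
     [0\<^sub>m n2 q1, 0\<^sub>m n2 n1, 0\<^sub>m n2 q3, window n1 (q1 + n1 + q3) n2 n2 T, window n1 (q1 + n1 + q3 + n2) n2 n3 T],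
     [0\<^sub>m n3 q1, 0\<^sub>m n3 n1, 0\<^sub>m n3 q3, 0\<^sub>m n3 n2, window (n1 + n2) (q1 + n1 + q3 + n2) n3 n3 T],
     [0\<^sub>m n4 q1, 0\<^sub>m n4 n1, 0\<^sub>m n4 q3, 0\<^sub>m n4 n2, 0\<^sub>m n4 n3]]" (is "T = block_mat ?rs ?n ?W")
proof -
  let ?p = "n1 + n2 + n3 + n4"
  have z1: "window d e r c T = 0\<^sub>m r c" if "d + r \<le> ?p" "e + c \<le> ?n" "e + c \<le> q1 + d \<and> e + c \<le> q1 + n1" for d e r c
    by (rule window_eq_zero, rule zero) (use that in linarith)+
  have z2: "window d e r c T = 0\<^sub>m r c" if "d + r \<le> ?p" "e + c \<le> ?n" "n1 \<le> d \<and> e + c + n1 \<le> q1 + n1 + q3 + d" for d e r c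
    by (rule window_eq_zero, rule zero) (use that in linarith)+
  have "window_rows 0 ?rs [q1, n1, q3, n2, n3] T = ?W" by (simp add: z1 z2)
  moreover have "sum_list [q1, n1, q3, n2, n3] = ?n" by simp
  moreover have "T = block_mat ?rs (sum_list [q1, n1, q3, n2, n3]) (window_rows 0 ?rs [q1, n1, q3, n2, n3] T)"
    by (rule block_mat_windows_all) (use T in \<open>simp add: add.assoc\<close>)
  ultimately show ?thesis by (simp only:)
qed

text \<open>Translates the three window forms, with r = p1 + l + x and k = l + x, into the staircase
  of \<open>block_form_B\<close>. In rows before \<open>p1\<close>, the bound
  \<open>h \<le> p1\<close> makes the other two disjuncts imply the first.\<close>

lemma reduced_B_zero:
  assumes bot: "bottom_reduced (p1 + l + x + s + p5) (m1 + h + l + s) (p1 + l + x) s K"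
    and mid: "middle_reduced (p1 + l + x) (l + x) (m1 + h + l) l \<sigma> K"
    and top: "top_reduced p1 (m1 + h) h K" and h: "h \<le> p1"
    and ij: "i < p1 + l + x + s + p5" "j < m1 + h + l + s"
    and zero: "j < m1 + h \<and> j < m1 + i \<or> j < m1 + h + l \<and> j + p1 < m1 + h + i \<or>
      j + (p1 + l + x) < m1 + h + l + i"
  shows "K $$ (i, j) = 0"
proof -
  consider "i < p1" | "p1 \<le> i" "i < p1 + l + x" | "p1 + l + x \<le> i" by linarith
  then show ?thesis
  proof cases
    case 1
    have j: "j < m1 + h" "j < m1 + i" using zero 1 h by linarith+
    hence "j \<noteq> m1 + h - h + i" by simp
    thus ?thesis using top 1 j(1) unfolding top_reduced_def by simp
  next
    case 2
    have j: "j < m1 + h + l" using zero 2 by linarith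
    have i: "p1 + l + x - (l + x) \<le> i" using 2 by simp
    have "j \<noteq> m1 + h + l - l + (i - (p1 + l + x - (l + x)))" using zero 2 by auto
    thus ?thesis using middle_reducedD[OF mid i 2(2) j] by simp
  next
    case 3
    have "j \<noteq> m1 + h + l + s - s + (i - (p1 + l + x))" using zero 3 by auto
    thus ?thesis using bottom_reducedD[OF bot 3 ij] by simp
  qed
qed

lemma reduced_C_zero:
  assumes left: "left_reduced (t + l + x + n4) (q1 + t) t K"
    and cor: "corner_reduced (t + l + x + n4) (q1 + t) (p1 + l + x) t (l + x) K"
    and ij: "i < t + l + x + n4" "j < q1 + t + p1 + l + x"
    and zero: "j < q1 + i \<and> j < q1 + t \<or> t \<le> i \<and> j + t < q1 + t + p1 + i"
  shows "K $$ (i, j) = 0"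
proof (cases "j < q1 + t")
  case True
  have "\<not> (j = q1 + t - t + i \<and> i < t)" using zero True by auto
  thus ?thesis using left True ij unfolding left_reduced_def by simp
next
  case False
  have i: "t \<le> i" and j: "q1 + t \<le> j" "j < q1 + t + (p1 + l + x)" using zero False ij by auto
  have "j - (q1 + t) \<noteq> p1 + l + x - (l + x) + (i - t)" using zero False i by auto
  thus ?thesis using corner_reducedD[OF cor i ij(1) j] by simp
qed

text \<open>Invertibility comes from factoring the window into diagonal windows of \<open>R\<close>
  and \<open>S\<close>, which are triangular with nonzero diagonal.\<close>

lemma diagonal_window_A:
  assumes R: "inverse_pair p R Ri" "upper_triangular R" and S: "inverse_pair q S Si" "upper_triangular S"
    and r: "r \<le> p" "a + r = q" and d: "d + l \<le> r" and e: "e = a + d"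
  defines "T \<equiv> R * unit_diagonal p q a r * S"
  shows "invertible_mat (window d e l l T)" "upper_triangular (window d e l l T)"
proof -
  have Rc: "R \<in> carrier_mat p p" and Sc: "S \<in> carrier_mat q q"
    using R(1) S(1) unfolding inverse_pair_def by blast+
  have dp: "d + l \<le> p" and aq: "a + d + l \<le> q" using d r by linarith+
  obtain N where N: "inverse_pair l (window d d l l R) N"
    by (rule window_triangular_inverse_pair[OF R dp]) (rule that)
  obtain M where M: "inverse_pair l (window (a + d) (a + d) l l S) M"
    by (rule window_triangular_inverse_pair[OF S aq]) (rule that)
  show "invertible_mat (window d e l l T)"
    unfolding T_def e triangular_A_window[OF Rc R(2) Sc S(2) r d]
    by (rule inverse_pair_invertible[OF inverse_pair_mult[OF N M]])
  show "upper_triangular (window d e l l T)"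
  proof (rule upper_triangularI)
    fix i j assume "j < i" "i < dim_row (window d e l l T)"
    hence ij: "j < i" "i < l" "j < l" by simp_all
    show "window d e l l T $$ (i, j) = 0"
      unfolding index_window[OF ij(2,3)] T_def e
      by (rule triangular_A_zero[OF Rc R(2) Sc S(2) r]) (use ij dp aq in linarith)+
  qed
qed

section \<open>Assembly of the triangular block forms and the diagonal product\<close>

theorem mainTheorem1:
  fixes A B C :: "real mat" and p q m n :: nat
  assumes "A \<in> carrier_mat p q"
    and "B \<in> carrier_mat p m"
    and "C \<in> carrier_mat n q"
  shows "\<exists>P Q U V.
         P \<in> carrier_mat p p \<and> orthonormal_mat P \<and>
         Q \<in> carrier_mat q q \<and> orthonormal_mat Q \<and>
         U \<in> carrier_mat m m \<and> orthonormal_mat U \<and>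
         V \<in> carrier_mat n n \<and> orthonormal_mat V \<and>
       (\<exists>p1 p2 p3 p4 p5 q1 q2 q3 q4 q5 m1 m2 m3 m4 n1 n2 n3 n4 :: nat.
         p1 + p2 + p3 + p4 + p5 = p \<and>
         q1 + q2 + q3 + q4 + q5 = q \<and>
         m1 + m2 + m3 + m4 = m \<and>
         n1 + n2 + n3 + n4 = n \<and>
       (\<exists>A13 A14 A15 A24 A25 A35
         B12 B13 B14 B23 B24 B34 B44
         C12 C13 C14 C15 C24 C25 C35 A24inv \<Sigma>.
         A13 \<in> carrier_mat p1 q3 \<and> A14 \<in> carrier_mat p1 q4 \<and> A15 \<in> carrier_mat p1 q5 \<and>
         A24 \<in> carrier_mat p2 q4 \<and> A25 \<in> carrier_mat p2 q5 \<and> A35 \<in> carrier_mat p3 q5 \<and>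
         B12 \<in> carrier_mat p1 m2 \<and> B13 \<in> carrier_mat p1 m3 \<and> B14 \<in> carrier_mat p1 m4 \<and>
         B23 \<in> carrier_mat p2 m3 \<and> B24 \<in> carrier_mat p2 m4 \<and> B34 \<in> carrier_mat p3 m4 \<and>
         B44 \<in> carrier_mat p4 m4 \<and>
         C12 \<in> carrier_mat n1 q2 \<and> C13 \<in> carrier_mat n1 q3 \<and> C14 \<in> carrier_mat n1 q4 \<and>
         C15 \<in> carrier_mat n1 q5 \<and> C24 \<in> carrier_mat n2 q4 \<and> C25 \<in> carrier_mat n2 q5 \<and>
         C35 \<in> carrier_mat n3 q5 \<and>
         transpose_mat P * A * Q =
           block_mat [p1, p2, p3, p4, p5] (q1 + q2 + q3 + q4 + q5)
             [[0\<^sub>m p1 q1, 0\<^sub>m p1 q2, A13, A14, A15],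
              [0\<^sub>m p2 q1, 0\<^sub>m p2 q2, 0\<^sub>m p2 q3, A24, A25],
              [0\<^sub>m p3 q1, 0\<^sub>m p3 q2, 0\<^sub>m p3 q3, 0\<^sub>m p3 q4, A35],
              [0\<^sub>m p4 q1, 0\<^sub>m p4 q2, 0\<^sub>m p4 q3, 0\<^sub>m p4 q4, 0\<^sub>m p4 q5],
              [0\<^sub>m p5 q1, 0\<^sub>m p5 q2, 0\<^sub>m p5 q3, 0\<^sub>m p5 q4, 0\<^sub>m p5 q5]] \<and>
         transpose_mat P * B * U =
           block_mat [p1, p2, p3, p4, p5] (m1 + m2 + m3 + m4)
             [[0\<^sub>m p1 m1, B12, B13, B14],
              [0\<^sub>m p2 m1, 0\<^sub>m p2 m2, B23, B24],
              [0\<^sub>m p3 m1, 0\<^sub>m p3 m2, 0\<^sub>m p3 m3, B34],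
              [0\<^sub>m p4 m1, 0\<^sub>m p4 m2, 0\<^sub>m p4 m3, B44],
              [0\<^sub>m p5 m1, 0\<^sub>m p5 m2, 0\<^sub>m p5 m3, 0\<^sub>m p5 m4]] \<and>
         transpose_mat V * C * Q =
           block_mat [n1, n2, n3, n4] (q1 + q2 + q3 + q4 + q5)
             [[0\<^sub>m n1 q1, C12, C13, C14, C15],
              [0\<^sub>m n2 q1, 0\<^sub>m n2 q2, 0\<^sub>m n2 q3, C24, C25],
              [0\<^sub>m n3 q1, 0\<^sub>m n3 q2, 0\<^sub>m n3 q3, 0\<^sub>m n3 q4, C35],
              [0\<^sub>m n4 q1, 0\<^sub>m n4 q2, 0\<^sub>m n4 q3, 0\<^sub>m n4 q4, 0\<^sub>m n4 q5]] \<and>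
         invertible_mat A13 \<and> upper_triangular A13 \<and>
         invertible_mat A24 \<and> upper_triangular A24 \<and>
         invertible_mat A35 \<and> upper_triangular A35 \<and>
         invertible_mat B44 \<and> upper_triangular B44 \<and>
         invertible_mat C12 \<and> upper_triangular C12 \<and>
         square_mat B23 \<and> upper_triangular B23 \<and>
         square_mat C24 \<and> upper_triangular C24 \<and>
         m2 \<le> p1 \<and> upper_trapezoidal B12 \<and>
         n3 \<le> q5 \<and> upper_trapezoidal C35 \<and>
         A24inv \<in> carrier_mat q4 p2 \<and> inverts_mat A24 A24inv \<and> inverts_mat A24inv A24 \<and>
         C24 * A24inv * B23 = \<Sigma> \<and>
         \<Sigma> \<in> carrier_mat n2 m3 \<and> diagonal_mat \<Sigma> \<and> (\<forall>i < min n2 m3. \<Sigma> $$ (i, i) \<ge> 0)))"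
proof -
  note A = assms(1) and B = assms(2) and C = assms(3)
  obtain a r s t k l h \<sigma> B' C' where r: "r \<le> p" "a + r = q" and s: "s \<le> p - r" "s \<le> m"
    and t: "t \<le> n" "t \<le> a" and k: "k \<le> n - t" "k \<le> r" and l: "l \<le> k" "l \<le> m - s"
    and h: "h \<le> r - k" "h \<le> m - s - l" and \<sigma>: "\<forall>i<l. 0 < \<sigma> i"
    and equiv: "simul_equiv p q m n A B C (unit_diagonal p q a r) B' C'"
    and bot: "bottom_reduced p m r s B'" and left: "left_reduced n a t C'"
    and cor: "corner_reduced n a r t k C'" and mid: "middle_reduced r k (m - s) l \<sigma> B'"
    and top: "top_reduced (r - k) (m - s - l) h B'"
    using restricted_svd[OF A B C] by blast
  obtain X Xi Y Yi U V where X: "inverse_pair p X Xi" and Y: "inverse_pair q Y Yi"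
    and U: "U \<in> carrier_mat m m" "orthonormal_mat U" and V: "V \<in> carrier_mat n n" "orthonormal_mat V"
    and XAY: "unit_diagonal p q a r = X * A * Y" and XBU: "B' = X * B * U" and VCY: "C' = V * C * Y"
    using equiv unfolding simul_equiv_def by blast
  have Xc: "X \<in> carrier_mat p p" "Xi \<in> carrier_mat p p" "Xi * X = 1\<^sub>m p"
    and Yc: "Y \<in> carrier_mat q q" "Yi \<in> carrier_mat q q" "Y * Yi = 1\<^sub>m q"
    using X Y unfolding inverse_pair_def by blast+
  \<comment> \<open>\<open>W\<close> is the transpose of the final P; likewise the final V is the
    transpose of the present \<open>V\<close>.\<close>
  obtain W where W: "W \<in> carrier_mat p p" "orthonormal_mat W" and triR: "upper_triangular (W * Xi)"
    using qr_decomposition[OF Xc(2)] by blast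
  obtain Q where Q: "Q \<in> carrier_mat q q" "orthonormal_mat Q" and triS: "upper_triangular (Yi * Q)"
    using rq_decomposition[OF Yc(2)] by blast
  define R where "R = W * Xi"
  define S where "S = Yi * Q"
  note R = inverse_pair_mult[OF inverse_pair_orthonormal[OF W] inverse_pair_sym[OF X], folded R_def] triR[folded R_def]
  note S = inverse_pair_mult[OF inverse_pair_sym[OF Y] inverse_pair_orthonormal[OF Q], folded S_def] triS[folded S_def]
  have Rc: "R \<in> carrier_mat p p" and Sc: "S \<in> carrier_mat q q"
    using R(1) S(1) unfolding inverse_pair_def by blast+
  have RX: "R * X = W"
    unfolding R_def assoc_mult_mat[OF W(1) Xc(2,1)] Xc(3) by (rule right_mult_one_mat[OF W(1)])
  have YS: "Y * S = Q"
    unfolding S_def assoc_mult_mat[OF Yc(1,2) Q(1), symmetric] Yc(3) by (rule left_mult_one_mat[OF Q(1)])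
  define TA where "TA = R * unit_diagonal p q a r * S"
  define TB where "TB = R * B'"
  define TC where "TC = C' * S"
  have B'c: "B' \<in> carrier_mat p m" and C'c: "C' \<in> carrier_mat n q"
    using simul_equiv_carrier[OF equiv] by blast+
  have TA: "transpose_mat (transpose_mat W) * A * Q = TA"
    unfolding TA_def XAY transpose_transpose RX[symmetric] YS[symmetric]
    by (rule mat_mult_regroup[OF Rc Xc(1) A Yc(1) Sc])
  \<comment> \<open>An identity stands in for the missing right factor in
    \<open>mat_mult_regroup\<close>, and below for the missing left one.\<close>
  have "W * B * U = R * B'"
    using mat_mult_regroup[OF Rc Xc(1) B U(1) one_carrier_mat]
    unfolding RX XBU[symmetric] right_mult_one_mat[OF U(1)] right_mult_one_mat[OF mult_carrier_mat[OF Rc B'c]] .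
  hence TB: "transpose_mat (transpose_mat W) * B * U = TB"
    unfolding TB_def transpose_transpose .
  have "V * C * Q = C' * S"
    using mat_mult_regroup[OF one_carrier_mat V(1) C Yc(1) Sc]
    unfolding YS left_mult_one_mat[OF V(1)] VCY[symmetric] left_mult_one_mat[OF C'c] .
  hence TC: "transpose_mat (transpose_mat V) * C * Q = TC"
    unfolding TC_def transpose_transpose .

  \<comment> \<open>From ranks to block sizes: rows of A and B split as p1, l, x, s, p5; columns of
    A and C as q1, t, p1, l, x; columns of B as m1, h, l, s; rows of C as t, l, x, n4.\<close>
  define p1 where "p1 = r - k"
  define x where "x = k - l"
  define p5 where "p5 = p - r - s"
  define q1 where "q1 = a - t"
  define m1 where "m1 = m - s - l - h"
  define n4 where "n4 = n - t - k"
  have k_eq: "k = l + x" using l unfolding x_def by simp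
  have r_eq: "r = p1 + l + x" using k k_eq unfolding p1_def by simp
  have a_eq: "a = q1 + t" using t unfolding q1_def by simp
  have p_eq: "p1 + l + x + s + p5 = p" using r s r_eq unfolding p5_def by simp
  have q_eq: "q1 + t + p1 + l + x = q" using r r_eq a_eq by simp
  have m_eq: "m1 + h + l + s = m" using s l h unfolding m1_def by simp
  have n_eq: "t + l + x + n4 = n" using t k k_eq unfolding n4_def by simp
  have hp1: "h \<le> p1" using h unfolding p1_def by simp
  have ms: "m - s = m1 + h + l" "m - s - l = m1 + h" using m_eq by simp_all
  have apr: "p1 + l + x \<le> p" "q1 + t + (p1 + l + x) = q" using r unfolding r_eq a_eq by simp_all
  note bot = bot[folded p_eq m_eq, unfolded r_eq]
  note mid = mid[unfolded ms r_eq k_eq]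
  note top = top[unfolded ms(2), folded p1_def]
  note left = left[folded n_eq, unfolded a_eq]
  note cor = cor[folded n_eq, unfolded a_eq r_eq k_eq]
  have KB_zero: "B' $$ (i, j) = 0" if "i < p" "j < m"
    "j < m1 + h \<and> j < m1 + i \<or> j < m1 + h + l \<and> j + p1 < m1 + h + i \<or> j + (p1 + l + x) < m1 + h + l + i" for i j
    by (rule reduced_B_zero[OF bot mid top hp1 _ _ that(3)]) (use that p_eq m_eq in simp_all)
  have KC_zero: "C' $$ (i, j) = 0" if "i < n" "j < q"
    "j < q1 + i \<and> j < q1 + t \<or> t \<le> i \<and> j + t < q1 + t + p1 + i" for i j
    by (rule reduced_C_zero[OF left cor _ _ that(3)]) (use that n_eq q_eq in simp_all)
  have TA_zero: "TA $$ (i, j) = 0" if "i < p" "j < q" "j < q1 + t + i" for i j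
    unfolding TA_def by (rule triangular_A_zero[OF Rc R(2) Sc S(2) r]) (use that a_eq in simp_all)
  \<comment> \<open>The zero region is closed under moving down within a column, so it survives
    multiplication by \<open>R\<close>; for C it is closed under moving left within a row.\<close>
  have TB_zero: "TB $$ (i, j) = 0" if "i < p" "j < m"
    "j < m1 + h \<and> j < m1 + i \<or> j < m1 + h + l \<and> j + p1 < m1 + h + i \<or> j + (p1 + l + x) < m1 + h + l + i" for i j
    unfolding TB_def
  proof (rule upper_mult_zero[OF Rc R(2) B'c that(1,2)])
    fix k assume k: "i \<le> k" "k < p"
    show "B' $$ (k, j) = 0" by (rule KB_zero[OF k(2) that(2)]) (use that(3) k(1) in linarith)
  qed
  have TC_zero: "TC $$ (i, j) = 0" if "i < n" "j < q"
    "j < q1 + i \<and> j < q1 + t \<or> t \<le> i \<and> j + t < q1 + t + p1 + i" for i j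
    unfolding TC_def
  proof (rule mult_upper_zero[OF C'c Sc S(2) that(1,2)])
    fix k assume k: "k \<le> j"
    show "C' $$ (i, k) = 0" by (rule KC_zero[OF that(1)]) (use that k in linarith)+
  qed
  have TA_carrier: "TA \<in> carrier_mat (p1 + l + x + s + p5) (q1 + t + p1 + l + x)"
    unfolding p_eq q_eq TA_def by (rule mult_carrier_mat[OF mult_carrier_mat[OF Rc unit_diagonal_carrier] Sc])
  have TB_carrier: "TB \<in> carrier_mat (p1 + l + x + s + p5) (m1 + h + l + s)"
    unfolding p_eq m_eq TB_def by (rule mult_carrier_mat[OF Rc B'c])
  have TC_carrier: "TC \<in> carrier_mat (t + l + x + n4) (q1 + t + p1 + l + x)"
    unfolding n_eq q_eq TC_def by (rule mult_carrier_mat[OF C'c Sc])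
  have A_zero: "TA $$ (i, j) = 0" if "i < p1 + l + x + s + p5" "j < q1 + t + p1 + l + x" "j < q1 + t + i" for i j
    using TA_zero that unfolding p_eq q_eq by blast
  have B_zero: "TB $$ (i, j) = 0" if "i < p1 + l + x + s + p5" "j < m1 + h + l + s"
    "j < m1 + h \<and> j < m1 + i \<or> j < m1 + h + l \<and> j + p1 < m1 + h + i \<or> j + (p1 + l + x) < m1 + h + l + i" for i j
    by (rule TB_zero[OF _ _ that(3)]) (use that p_eq m_eq in simp_all)
  have C_zero: "TC $$ (i, j) = 0" if "i < t + l + x + n4" "j < q1 + t + p1 + l + x"
    "j < q1 + i \<and> j < q1 + t \<or> t \<le> i \<and> j + t < q1 + t + p1 + i" for i j
    by (rule TC_zero[OF _ _ that(3)]) (use that n_eq q_eq in simp_all)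
  note diagA = diagonal_window_A[OF R S apr, folded a_eq r_eq, folded TA_def, unfolded a_eq r_eq]
  \<comment> \<open>A13, A24 and A35 are the diagonal windows at row offsets 0, \<open>p1\<close>
    and \<open>p1 + l\<close>.\<close>
  have A13: "invertible_mat (window 0 (q1 + t) p1 p1 TA)" "upper_triangular (window 0 (q1 + t) p1 p1 TA)"
    by (rule diagA; simp)+
  have A24: "invertible_mat (window p1 (q1 + t + p1) l l TA)" "upper_triangular (window p1 (q1 + t + p1) l l TA)"
    by (rule diagA; simp)+
  have A35: "invertible_mat (window (p1 + l) (q1 + t + p1 + l) x x TA)"
    "upper_triangular (window (p1 + l) (q1 + t + p1 + l) x x TA)"
    by (rule diagA; simp)+

  have B44_tri: "upper_triangular (window (p1 + l + x) (m1 + h + l) s s TB)"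
  proof (rule upper_triangularI)
    fix i j assume "j < i" "i < dim_row (window (p1 + l + x) (m1 + h + l) s s TB)"
    hence ij: "j < i" "i < s" "j < s" by simp_all
    show "window (p1 + l + x) (m1 + h + l) s s TB $$ (i, j) = 0"
      unfolding index_window[OF ij(2,3)] by (rule TB_zero) (use ij p_eq m_eq in linarith)+
  qed
  \<comment> \<open>Below its unit this column of \<open>B'\<close> is zero, so the diagonal entry
    of B44 is a diagonal entry of \<open>R\<close>. The same argument with \<open>S\<close> applies
    to C12.\<close>
  have B44_diag: "window (p1 + l + x) (m1 + h + l) s s TB $$ (i, i) \<noteq> 0" if i: "i < s" for i
  proof -
    have ip: "p1 + l + x + i < p" and jm: "m1 + h + l + i < m" using i p_eq m_eq by linarith+
    have "TB $$ (p1 + l + x + i, m1 + h + l + i)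
        = R $$ (p1 + l + x + i, p1 + l + x + i) * B' $$ (p1 + l + x + i, m1 + h + l + i)"
      unfolding TB_def
    proof (rule upper_mult_single[OF Rc R(2) B'c ip jm ip])
      fix k assume "p1 + l + x + i \<le> k" "k < p" "k \<noteq> p1 + l + x + i"
      thus "B' $$ (k, m1 + h + l + i) = 0" by (intro KB_zero) (use jm in linarith)+
    qed
    moreover have "B' $$ (p1 + l + x + i, m1 + h + l + i) = 1"
      using bottom_reducedD[OF bot, of "p1 + l + x + i" "m1 + h + l + i"] ip jm i p_eq m_eq by simp
    ultimately show ?thesis
      unfolding index_window[OF i i] using inverse_pair_triangular_diag[OF R ip] by simp
  qed
  obtain B44i where "inverse_pair s (window (p1 + l + x) (m1 + h + l) s s TB) B44i"
    using triangular_inverse_pair[OF window_carrier B44_tri B44_diag] by blast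
  hence B44: "invertible_mat (window (p1 + l + x) (m1 + h + l) s s TB)" by (rule inverse_pair_invertible)

  have C12_tri: "upper_triangular (window 0 q1 t t TC)"
  proof (rule upper_triangularI)
    fix i j assume "j < i" "i < dim_row (window 0 q1 t t TC)"
    hence ij: "j < i" "i < t" "j < t" by simp_all
    show "window 0 q1 t t TC $$ (i, j) = 0"
      unfolding index_window[OF ij(2,3)] by (rule TC_zero) (use ij n_eq q_eq in linarith)+
  qed
  have C12_diag: "window 0 q1 t t TC $$ (i, i) \<noteq> 0" if i: "i < t" for i
  proof -
    have iN: "i < n" and jq: "q1 + i < q" using i n_eq q_eq by linarith+
    have "TC $$ (i, q1 + i) = C' $$ (i, q1 + i) * S $$ (q1 + i, q1 + i)"
      unfolding TC_def
    proof (rule mult_upper_single[OF C'c Sc S(2) iN jq jq])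
      fix k assume "k \<le> q1 + i" "k \<noteq> q1 + i"
      thus "C' $$ (i, k) = 0" by (intro KC_zero[OF iN]) (use i jq in linarith)+
    qed
    moreover have "C' $$ (i, q1 + i) = 1"
      using left i iN n_eq unfolding left_reduced_def by simp
    ultimately show ?thesis
      unfolding index_window[OF i i] using inverse_pair_triangular_diag[OF S jq] by simp
  qed
  obtain C12i where "inverse_pair t (window 0 q1 t t TC) C12i"
    using triangular_inverse_pair[OF window_carrier C12_tri C12_diag] by blast
  hence C12: "invertible_mat (window 0 q1 t t TC)" by (rule inverse_pair_invertible)

  \<comment> \<open>The entries vanish already for \<open>j < i\<close>, which is more than the
    trapezoidal shape with its \<open>p1 - h\<close> full rows asks for.\<close>
  have B12: "upper_trapezoidal (window 0 m1 p1 h TB)"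
    unfolding upper_trapezoidal_def
  proof (intro allI impI)
    fix i j assume "i < dim_row (window 0 m1 p1 h TB)" "j < dim_col (window 0 m1 p1 h TB)"
      and "j + (dim_row (window 0 m1 p1 h TB) - dim_col (window 0 m1 p1 h TB)) < i"
    hence ij: "i < p1" "j < h" "j < i" by simp_all
    show "window 0 m1 p1 h TB $$ (i, j) = 0"
      unfolding index_window[OF ij(1,2)] by (rule TB_zero) (use ij p_eq m_eq in linarith)+
  qed
  \<comment> \<open>C35 comes out square, with n3 = q5 = x, so that trapezoidal here means
    triangular.\<close>
  have C35: "upper_trapezoidal (window (t + l) (q1 + t + p1 + l) x x TC)"
    unfolding upper_trapezoidal_def
  proof (intro allI impI)
    fix i j assume "i < dim_row (window (t + l) (q1 + t + p1 + l) x x TC)"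
      "j < dim_col (window (t + l) (q1 + t + p1 + l) x x TC)"
      and "j + (dim_row (window (t + l) (q1 + t + p1 + l) x x TC) -
        dim_col (window (t + l) (q1 + t + p1 + l) x x TC)) < i"
    hence ij: "i < x" "j < x" "j < i" by simp_all
    show "window (t + l) (q1 + t + p1 + l) x x TC $$ (i, j) = 0"
      unfolding index_window[OF ij(1,2)] by (rule TC_zero) (use ij n_eq q_eq in linarith)+
  qed

  define \<Sigma> where "\<Sigma> = mat l l (\<lambda>(i, j). if i = j then \<sigma> i else 0)"
  define R2 where "R2 = window p1 p1 l l R"
  define S4 where "S4 = window (q1 + t + p1) (q1 + t + p1) l l S"
  have \<Sigma>: "\<Sigma> \<in> carrier_mat l l" unfolding \<Sigma>_def by simp
  have pl: "p1 + l \<le> p" and ql: "q1 + t + p1 + l \<le> q" using p_eq q_eq by linarith+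
  have R2c: "R2 \<in> carrier_mat l l" and S4c: "S4 \<in> carrier_mat l l" unfolding R2_def S4_def by simp_all
  obtain R2i where R2: "inverse_pair l R2 R2i"
    using window_triangular_inverse_pair[OF R pl] unfolding R2_def by blast
  obtain S4i where S4: "inverse_pair l S4 S4i"
    using window_triangular_inverse_pair[OF S ql] unfolding S4_def by blast
  have A24_eq: "window p1 (q1 + t + p1) l l TA = R2 * S4"
    unfolding TA_def R2_def S4_def a_eq r_eq
    by (rule triangular_A_window[OF Rc R(2) Sc S(2) apr]) simp
  \<comment> \<open>From row \<open>p1\<close> downwards, column \<open>m1 + h + j\<close> of
    \<open>B'\<close> has the single entry \<open>\<sigma> j\<close>, in row
    \<open>p1 + j\<close>.\<close>
  have B23_entry: "TB $$ (p1 + i, m1 + h + j) = R $$ (p1 + i, p1 + j) * \<sigma> j" if ij: "i < l" "j < l" for i j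
  proof -
    have ip: "p1 + i < p" and jp: "p1 + j < p" and jm: "m1 + h + j < m" using ij p_eq m_eq by linarith+
    have col: "B' $$ (k, m1 + h + j) = (if j = k - p1 then \<sigma> (k - p1) else 0)"
      if k: "p1 \<le> k" "k < p1 + l + x" for k
    proof -
      have "p1 + l + x - (l + x) \<le> k" "m1 + h + j < m1 + h + l" using k ij by simp_all
      from middle_reducedD[OF mid this(1) k(2) this(2)] show ?thesis using ij by auto
    qed
    have "TB $$ (p1 + i, m1 + h + j) = R $$ (p1 + i, p1 + j) * B' $$ (p1 + j, m1 + h + j)"
      unfolding TB_def
    proof (rule upper_mult_single[OF Rc R(2) B'c ip jm jp])
      fix k assume k: "p1 + i \<le> k" "k < p" "k \<noteq> p1 + j"
      show "B' $$ (k, m1 + h + j) = 0"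
      proof (cases "k < p1 + l + x")
        case True
        thus ?thesis using col[of k] k by auto
      next
        case False
        thus ?thesis by (intro KB_zero[OF k(2) jm]) (use ij in linarith)
      qed
    qed
    moreover have "B' $$ (p1 + j, m1 + h + j) = \<sigma> j" using col[of "p1 + j"] ij by simp
    ultimately show ?thesis by simp
  qed
  have B23_eq: "window p1 (m1 + h) l l TB = R2 * \<Sigma>"
  proof (rule eq_matI)
    fix i j assume "i < dim_row (R2 * \<Sigma>)" "j < dim_col (R2 * \<Sigma>)"
    hence ij: "i < l" "j < l" using R2c \<Sigma> by simp_all
    have "(R2 * \<Sigma>) $$ (i, j) = (\<Sum>k<l. R2 $$ (i, k) * \<Sigma> $$ (k, j))"
      by (rule index_mult_mat_sum[OF R2c \<Sigma> ij])
    also have "\<dots> = (\<Sum>k<l. if k = j then R $$ (p1 + i, p1 + j) * \<sigma> j else 0)"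
      by (rule sum.cong) (use ij in \<open>auto simp: R2_def \<Sigma>_def\<close>)
    also have "\<dots> = R $$ (p1 + i, p1 + j) * \<sigma> j" using ij by (subst sum.delta) auto
    finally show "window p1 (m1 + h) l l TB $$ (i, j) = (R2 * \<Sigma>) $$ (i, j)"
      unfolding index_window[OF ij] B23_entry[OF ij] ..
  qed (use R2c \<Sigma> in simp_all)
  have C24_eq: "window t (q1 + t + p1) l l TC = S4"
  proof (rule eq_matI)
    fix i j assume "i < dim_row S4" "j < dim_col S4"
    hence ij: "i < l" "j < l" using S4c by simp_all
    have iN: "t + i < n" and iq: "q1 + t + p1 + i < q" and jq: "q1 + t + p1 + j < q"
      using ij n_eq q_eq by linarith+
    \<comment> \<open>From column \<open>q1 + t\<close> on, row \<open>t + i\<close> of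
      \<open>C'\<close> is a unit vector, and its earlier entries vanish; hence it picks one row of
      \<open>S\<close>.\<close>
    have row: "C' $$ (t + i, k) = (if k = q1 + t + p1 + i then 1 else 0)" if "k < q" "q1 + t \<le> k" for k
      using corner_reducedD[OF cor, of "t + i" k] that ij iN n_eq q_eq by auto
    have "TC $$ (t + i, q1 + t + p1 + j) = C' $$ (t + i, q1 + t + p1 + i) * S $$ (q1 + t + p1 + i, q1 + t + p1 + j)"
      unfolding TC_def
    proof (rule mult_upper_single[OF C'c Sc S(2) iN jq iq])
      fix k assume k: "k \<le> q1 + t + p1 + j" "k \<noteq> q1 + t + p1 + i"
      hence kq: "k < q" using jq by simp
      show "C' $$ (t + i, k) = 0"
      proof (cases "q1 + t \<le> k")
        case True
        thus ?thesis using row[OF kq] k by simp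
      next
        case False
        thus ?thesis by (intro KC_zero[OF iN kq]) linarith
      qed
    qed
    thus "window t (q1 + t + p1) l l TC $$ (i, j) = S4 $$ (i, j)"
      unfolding index_window[OF ij] S4_def using row[OF iq] by simp
  qed (use S4c in simp_all)
  have S4_tri: "upper_triangular S4" unfolding S4_def by (rule upper_triangular_window[OF Sc S(2) ql])
  have B23: "upper_triangular (window p1 (m1 + h) l l TB)"
  proof (rule upper_triangularI)
    fix i j assume "j < i" "i < dim_row (window p1 (m1 + h) l l TB)"
    hence ij: "j < i" "i < l" "j < l" by simp_all
    show "window p1 (m1 + h) l l TB $$ (i, j) = 0"
      unfolding index_window[OF ij(2,3)] by (rule TB_zero) (use ij p_eq m_eq in linarith)+
  qed
  have C24: "upper_triangular (window t (q1 + t + p1) l l TC)" unfolding C24_eq by (rule S4_tri)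
  note A24_pair = inverse_pair_mult[OF R2 S4, folded A24_eq]
  have Nc: "S4i * R2i \<in> carrier_mat l l" using A24_pair unfolding inverse_pair_def by blast
  have R2ic: "R2i \<in> carrier_mat l l" "R2i * R2 = 1\<^sub>m l"
    using R2 unfolding inverse_pair_def by simp_all
  have S4ic: "S4i \<in> carrier_mat l l" "S4 * S4i = 1\<^sub>m l"
    using S4 unfolding inverse_pair_def by simp_all
  have A24_inv: "inverts_mat (window p1 (q1 + t + p1) l l TA) (S4i * R2i)"
    "inverts_mat (S4i * R2i) (window p1 (q1 + t + p1) l l TA)"
    using A24_pair S4ic(1) unfolding inverse_pair_def inverts_mat_def by simp_all
  \<comment> \<open>The product is S4 (S4^{-1} R2^{-1}) (R2 \<Sigma>), in which both triangular
    blocks cancel.\<close>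
  have "S4 * (S4i * R2i) = R2i"
    unfolding assoc_mult_mat[OF S4c S4ic(1) R2ic(1), symmetric] S4ic(2) by (rule left_mult_one_mat[OF R2ic(1)])
  moreover have "R2i * (R2 * \<Sigma>) = \<Sigma>"
    unfolding assoc_mult_mat[OF R2ic(1) R2c \<Sigma>, symmetric] R2ic(2) by (rule left_mult_one_mat[OF \<Sigma>])
  ultimately have prod: "window t (q1 + t + p1) l l TC * (S4i * R2i) * window p1 (m1 + h) l l TB = \<Sigma>"
    unfolding C24_eq B23_eq by simp
  have \<Sigma>_diag: "diagonal_mat \<Sigma>" unfolding diagonal_mat_def \<Sigma>_def by simp
  have \<Sigma>_nonneg: "\<forall>i<min l l. \<Sigma> $$ (i, i) \<ge> 0" using \<sigma> unfolding \<Sigma>_def by (auto intro: less_imp_le)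
  have square: "square_mat (window d e l l T)" for d e and T by simp
  have WT: "transpose_mat W \<in> carrier_mat p p" "orthonormal_mat (transpose_mat W)"
    and VT: "transpose_mat V \<in> carrier_mat n n" "orthonormal_mat (transpose_mat V)"
    using W V by (simp_all add: orthonormal_mat_transpose[of _ p] orthonormal_mat_transpose[of _ n])
  show ?thesis
    apply (rule exI[of _ "transpose_mat W"], rule exI[of _ Q], rule exI[of _ U], rule exI[of _ "transpose_mat V"])
    apply (intro conjI)
    apply (fact+)[8]
    apply (rule exI[of _ p1], rule exI[of _ l], rule exI[of _ x], rule exI[of _ s], rule exI[of _ p5],
        rule exI[of _ q1], rule exI[of _ t], rule exI[of _ p1], rule exI[of _ l], rule exI[of _ x],
        rule exI[of _ m1], rule exI[of _ h], rule exI[of _ l], rule exI[of _ s],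
        rule exI[of _ t], rule exI[of _ l], rule exI[of _ x], rule exI[of _ n4])
    apply (intro conjI)
    apply (fact+)[4]
    apply (rule exI[of _ "window 0 (q1 + t) p1 p1 TA"], rule exI[of _ "window 0 (q1 + t + p1) p1 l TA"],
        rule exI[of _ "window 0 (q1 + t + p1 + l) p1 x TA"], rule exI[of _ "window p1 (q1 + t + p1) l l TA"],
        rule exI[of _ "window p1 (q1 + t + p1 + l) l x TA"],
        rule exI[of _ "window (p1 + l) (q1 + t + p1 + l) x x TA"],
        rule exI[of _ "window 0 m1 p1 h TB"], rule exI[of _ "window 0 (m1 + h) p1 l TB"],
        rule exI[of _ "window 0 (m1 + h + l) p1 s TB"], rule exI[of _ "window p1 (m1 + h) l l TB"],
        rule exI[of _ "window p1 (m1 + h + l) l s TB"], rule exI[of _ "window (p1 + l) (m1 + h + l) x s TB"],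
        rule exI[of _ "window (p1 + l + x) (m1 + h + l) s s TB"],
        rule exI[of _ "window 0 q1 t t TC"], rule exI[of _ "window 0 (q1 + t) t p1 TC"],
        rule exI[of _ "window 0 (q1 + t + p1) t l TC"], rule exI[of _ "window 0 (q1 + t + p1 + l) t x TC"],
        rule exI[of _ "window t (q1 + t + p1) l l TC"], rule exI[of _ "window t (q1 + t + p1 + l) l x TC"],
        rule exI[of _ "window (t + l) (q1 + t + p1 + l) x x TC"],
        rule exI[of _ "S4i * R2i"], rule exI[of _ \<Sigma>])
    apply (intro conjI)
    apply (rule window_carrier)+
    apply (rule trans[OF TA block_form_A[OF TA_carrier]], rule A_zero, assumption+)
    apply (rule trans[OF TB block_form_B[OF TB_carrier hp1]], rule B_zero, assumption+)
    apply (rule trans[OF TC block_form_C[OF TC_carrier]], rule C_zero, assumption+)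
    apply (rule order_refl square | fact)+
    done
qed

end
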